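(* Let $(\mathbb A,\mathsf E,\mathsf M)$ be a context, $(X,\mu)$, $(Y,\phi)$, $(Z,\psi)$ internal preneighbourhood spaces and $f:X\to Y$, $g:Y\to Z$ morphisms of $\mathbb A$. The following statements are true. (a) $f$ is a closed morphism if and only if for every $p\in\mathrm{Sub}(X)$: $\widehat{\mathrm{cl}}_\phi(\exists_f p)\leq\exists_f(\widehat{\mathrm{cl}}_\mu p)$. (b) If $f$ is continuous then $f$ is closed if and only if for every $p\in\mathrm{Sub}(X)$, $\exists_f(\widehat{\mathrm{cl}}_\mu p)=\widehat{\mathrm{cl}}_\phi(\exists_f p)$. In particular, $m\in\mathrm{Sub}(X)$, $m:M\to X$ (with $M$ carrying the restricted system $\mu|_m$), is a closed morphism if and only if $m\in\mathfrak C_\mu$. (c) The (possibly large) set of closed morphisms contains all isomorphisms of $\mathbb A$. (d) The set of closed morphisms is closed under compositions. (e) If $g\circ f$ is a closed morphism and $f$ is formally surjective and continuous then $g$ is a closed morphism. (f) If $f$ is a closed continuous morphism then for each $m\in\mathfrak C_\phi$ the corestriction $f_m$ of $f$ along $m$ is closed and continuous.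
   Context: A context is a triple $(\mathbb A,\mathsf E,\mathsf M)$ where $\mathbb A$ is a finitely complete category with finite coproducts, $(\mathsf E,\mathsf M)$ is a proper factorization system on $\mathbb A$ ($\mathsf E\subseteq$ epimorphisms, $\mathsf M\subseteq$ monomorphisms), and for each object $X$ the poset $\mathrm{Sub}(X)$ of admissible subobjects of $X$ ($\mathsf M$-morphisms with codomain $X$, equivalent ones identified) is a complete lattice, with largest element $\mathrm{id}_X$ and smallest element $\sigma_X$ (the $\mathsf M$-part of the factorization of the unique morphism from the initial object to $X$). For $f:X\to Y$, $\exists_f m$ is the $\mathsf M$-part of the factorization of $f\circ m$ ($m\in\mathrm{Sub}(X)$) and $f^{-1}n$ is the pullback of $n\in\mathrm{Sub}(Y)$ along $f$. For $n:N\to Y$ in $\mathsf M$, the corestriction $f_n:f^{-1}N\to N$ is the pullback of $f$ along $n$, with $f\circ(f^{-1}n)=n\circ f_n$; $f$ is formally surjective if $f_n\in\mathsf E$ for every $n\in\mathrm{Sub}(Y)$ (equivalently every $y\in\mathrm{Sub}(Y)$ is $\exists_f x$ for some $x\in\mathrm{Sub}(X)$). A filter on $X$ is a non-empty up-closed subset of $\mathrm{Sub}(X)$ closed under finite meets; the set $\mathrm{Fil}(X)$ of filters on $X$ is ordered by inclusion. A preneighbourhood system on $X$ is an order preserving map $\mu:\mathrm{Sub}(X)^{\mathrm{op}}\to\mathrm{Fil}(X)$ with $\mu(\sigma_X)=\mathrm{Sub}(X)$ and $p\in\mu(m)\Rightarrow m\leq p$; $(X,\mu)$ is then an internal preneighbourhood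 space. For $m:M\to X$ in $\mathsf M$ and a preneighbourhood system $\mu$ on $X$, $M$ carries the restricted system $\mu|_m(a)=\{u\in\mathrm{Sub}(M):(\exists v\in\mu(m\circ a))(m^{-1}v\leq u)\}$; thus $f_m$ is considered with respect to $(f^{-1}M,\mu|_{f^{-1}m})$ and $(M,\phi|_m)$. Define $\mathtt{Far}_\mu p=\{x\in\mathrm{Sub}(X):(\exists u\in\mu(x))(u\wedge p=\sigma_X)\}$, $\mathrm{cl}_\mu p=\bigvee\{x\in\mathrm{Sub}(X): p\not< x\text{ and }x\notin\mathtt{Far}_\mu p\}$, $\mathfrak C_\mu=\{p\in\mathrm{Sub}(X):\mathrm{cl}_\mu p=p\}$, and $\widehat{\mathrm{cl}}_\mu p=\bigwedge\{t\in\mathfrak C_\mu: p\leq t\}$. For preneighbourhood spaces $(X,\mu)$, $(Y,\phi)$, a morphism $f:X\to Y$ of $\mathbb A$ (not required to respect the preneighbourhood systems) is closed if $p\in\mathfrak C_\mu\Rightarrow\exists_f p\in\mathfrak C_\phi$, and continuous if $t\in\mathfrak C_\phi\Rightarrow f^{-1}t\in\mathfrak C_\mu$.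
   Formalization: Part (c) fails for unrelated systems (identity of a two-point set, discrete to indiscrete); it is proved for isomorphisms f whose inverse h is a preneighbourhood morphism: p∈μ(m) implies h⁻¹p∈φ(h⁻¹m). *)

theory Defs
  imports "HOL-Algebra.Complete_Lattice"
begin

section \<open>Categories, finite limits and finite coproducts\<close>

record ('o, 'a) cat =
  Obj :: "'o set"
  Arr :: "'a set"
  Dom :: "'a \<Rightarrow> 'o"
  Cod :: "'a \<Rightarrow> 'o"
  Idt :: "'o \<Rightarrow> 'a"
  Cmp :: "'a \<Rightarrow> 'a \<Rightarrow> 'a"  (infixr "\<cdot>\<index>" 75)

definition Hom :: "('o, 'a, 'z) cat_scheme \<Rightarrow> 'o \<Rightarrow> 'o \<Rightarrow> 'a set" where
  "Hom C X Y = {f \<in> Arr C. Dom C f = X \<and> Cod C f = Y}"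

text \<open>Composition \<open>g \<cdot> f\<close> is in applicative order and is only meaningful if
  \<open>Cod f = Dom g\<close>.\<close>

locale category =
  fixes C :: "('o, 'a, 'z) cat_scheme" (structure)
  assumes dom_in_Obj: "f \<in> Arr C \<Longrightarrow> Dom C f \<in> Obj C"
    and cod_in_Obj: "f \<in> Arr C \<Longrightarrow> Cod C f \<in> Obj C"
    and idt_in_Hom: "X \<in> Obj C \<Longrightarrow> Idt C X \<in> Hom C X X"
    and cmp_in_Hom: "\<lbrakk>f \<in> Hom C X Y; g \<in> Hom C Y Z\<rbrakk> \<Longrightarrow> g \<cdot> f \<in> Hom C X Z"
    and idt_right: "f \<in> Hom C X Y \<Longrightarrow> f \<cdot> Idt C X = f"
    and idt_left: "f \<in> Hom C X Y \<Longrightarrow> Idt C Y \<cdot> f = f"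
    and cmp_assoc: "\<lbrakk>f \<in> Hom C W X; g \<in> Hom C X Y; h \<in> Hom C Y Z\<rbrakk>
                     \<Longrightarrow> (h \<cdot> g) \<cdot> f = h \<cdot> (g \<cdot> f)"

definition inverse_arrows :: "('o, 'a, 'z) cat_scheme \<Rightarrow> 'a \<Rightarrow> 'a \<Rightarrow> bool" where
  "inverse_arrows C f h \<longleftrightarrow> f \<in> Arr C \<and> h \<in> Hom C (Cod C f) (Dom C f)
     \<and> h \<cdot>\<^bsub>C\<^esub> f = Idt C (Dom C f) \<and> f \<cdot>\<^bsub>C\<^esub> h = Idt C (Cod C f)"

definition is_iso :: "('o, 'a, 'z) cat_scheme \<Rightarrow> 'a \<Rightarrow> bool" where
  "is_iso C f \<longleftrightarrow> (\<exists>h. inverse_arrows C f h)"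

definition is_epi :: "('o, 'a, 'z) cat_scheme \<Rightarrow> 'a \<Rightarrow> bool" where
  "is_epi C e \<longleftrightarrow> e \<in> Arr C \<and>
     (\<forall>Z. \<forall>u \<in> Hom C (Cod C e) Z. \<forall>v \<in> Hom C (Cod C e) Z. u \<cdot>\<^bsub>C\<^esub> e = v \<cdot>\<^bsub>C\<^esub> e \<longrightarrow> u = v)"

definition is_mono :: "('o, 'a, 'z) cat_scheme \<Rightarrow> 'a \<Rightarrow> bool" where
  "is_mono C m \<longleftrightarrow> m \<in> Arr C \<and>
     (\<forall>W. \<forall>u \<in> Hom C W (Dom C m). \<forall>v \<in> Hom C W (Dom C m). m \<cdot>\<^bsub>C\<^esub> u = m \<cdot>\<^bsub>C\<^esub> v \<longrightarrow> u = v)"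

definition is_initial :: "('o, 'a, 'z) cat_scheme \<Rightarrow> 'o \<Rightarrow> bool" where
  "is_initial C I \<longleftrightarrow> I \<in> Obj C \<and> (\<forall>X \<in> Obj C. \<exists>!i. i \<in> Hom C I X)"

definition is_functor ::
  "('j, 'b, 'y) cat_scheme \<Rightarrow> ('o, 'a, 'z) cat_scheme \<Rightarrow> ('j \<Rightarrow> 'o) \<Rightarrow> ('b \<Rightarrow> 'a) \<Rightarrow> bool" where
  "is_functor J C Fo Fa \<longleftrightarrow>
     (\<forall>j \<in> Obj J. Fo j \<in> Obj C \<and> Fa (Idt J j) = Idt C (Fo j))
   \<and> (\<forall>a \<in> Arr J. Fa a \<in> Hom C (Fo (Dom J a)) (Fo (Cod J a)))
   \<and> (\<forall>a \<in> Arr J. \<forall>b \<in> Arr J. Cod J a = Dom J b \<longrightarrow> Fa (b \<cdot>\<^bsub>J\<^esub> a) = Fa b \<cdot>\<^bsub>C\<^esub> Fa a)"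

definition is_cone ::
  "('j, 'b, 'y) cat_scheme \<Rightarrow> ('o, 'a, 'z) cat_scheme \<Rightarrow> ('j \<Rightarrow> 'o) \<Rightarrow> ('b \<Rightarrow> 'a)
     \<Rightarrow> 'o \<Rightarrow> ('j \<Rightarrow> 'a) \<Rightarrow> bool" where
  "is_cone J C Fo Fa L \<pi> \<longleftrightarrow> L \<in> Obj C
   \<and> (\<forall>j \<in> Obj J. \<pi> j \<in> Hom C L (Fo j))
   \<and> (\<forall>a \<in> Arr J. Fa a \<cdot>\<^bsub>C\<^esub> \<pi> (Dom J a) = \<pi> (Cod J a))"

definition is_limit ::
  "('j, 'b, 'y) cat_scheme \<Rightarrow> ('o, 'a, 'z) cat_scheme \<Rightarrow> ('j \<Rightarrow> 'o) \<Rightarrow> ('b \<Rightarrow> 'a)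
     \<Rightarrow> 'o \<Rightarrow> ('j \<Rightarrow> 'a) \<Rightarrow> bool" where
  "is_limit J C Fo Fa L \<pi> \<longleftrightarrow> is_cone J C Fo Fa L \<pi>
   \<and> (\<forall>L' \<pi>'. is_cone J C Fo Fa L' \<pi>' \<longrightarrow>
        (\<exists>!h. h \<in> Hom C L' L \<and> (\<forall>j \<in> Obj J. \<pi> j \<cdot>\<^bsub>C\<^esub> h = \<pi>' j)))"

text \<open>Every finite category is isomorphic to one whose objects and arrows are natural numbers,
  so these index categories account for all finite diagrams; likewise for finite index sets of
  coproducts.\<close>

definition finitely_complete :: "('o, 'a, 'z) cat_scheme \<Rightarrow> bool" where
  "finitely_complete C \<longleftrightarrow>
     (\<forall>(J :: (nat, nat) cat) Fo Fa.
        category J \<and> finite (Obj J) \<and> finite (Arr J) \<and> is_functor J C Fo Fa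
        \<longrightarrow> (\<exists>L \<pi>. is_limit J C Fo Fa L \<pi>))"

definition is_coproduct ::
  "('o, 'a, 'z) cat_scheme \<Rightarrow> 'i set \<Rightarrow> ('i \<Rightarrow> 'o) \<Rightarrow> 'o \<Rightarrow> ('i \<Rightarrow> 'a) \<Rightarrow> bool" where
  "is_coproduct C I F S \<iota> \<longleftrightarrow> S \<in> Obj C \<and> (\<forall>i \<in> I. \<iota> i \<in> Hom C (F i) S)
   \<and> (\<forall>T \<in> Obj C. \<forall>\<tau>. (\<forall>i \<in> I. \<tau> i \<in> Hom C (F i) T) \<longrightarrow>
        (\<exists>!h. h \<in> Hom C S T \<and> (\<forall>i \<in> I. h \<cdot>\<^bsub>C\<^esub> \<iota> i = \<tau> i)))"

definition has_finite_coproducts :: "('o, 'a, 'z) cat_scheme \<Rightarrow> bool" where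
  "has_finite_coproducts C \<longleftrightarrow>
     (\<forall>(I :: nat set) F. finite I \<and> F ` I \<subseteq> Obj C \<longrightarrow> (\<exists>S \<iota>. is_coproduct C I F S \<iota>))"

text \<open>\<open>k : P \<rightarrow> X\<close> is a pullback of \<open>n : N \<rightarrow> Y\<close> along \<open>f : X \<rightarrow> Y\<close>, and \<open>h : P \<rightarrow> N\<close> is the
  corresponding corestriction \<open>f\<^sub>n\<close> of \<open>f\<close>.\<close>

definition is_pullback :: "('o, 'a, 'z) cat_scheme \<Rightarrow> 'a \<Rightarrow> 'a \<Rightarrow> 'a \<Rightarrow> 'a \<Rightarrow> bool" where
  "is_pullback C f n k h \<longleftrightarrow>
     f \<in> Arr C \<and> n \<in> Hom C (Dom C n) (Cod C f)
   \<and> k \<in> Hom C (Dom C k) (Dom C f) \<and> h \<in> Hom C (Dom C k) (Dom C n)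
   \<and> f \<cdot>\<^bsub>C\<^esub> k = n \<cdot>\<^bsub>C\<^esub> h
   \<and> (\<forall>Q. \<forall>a \<in> Hom C Q (Dom C f). \<forall>b \<in> Hom C Q (Dom C n). f \<cdot>\<^bsub>C\<^esub> a = n \<cdot>\<^bsub>C\<^esub> b \<longrightarrow>
        (\<exists>!u. u \<in> Hom C Q (Dom C k) \<and> k \<cdot>\<^bsub>C\<^esub> u = a \<and> h \<cdot>\<^bsub>C\<^esub> u = b))"


section \<open>Proper factorization systems and admissible subobjects\<close>

record ('o, 'a) fact_cat = "('o, 'a) cat" +
  EE :: "'a set"
  MM :: "'a set"

locale proper_factorization_system = category C
  for C :: "('o, 'a) fact_cat" (structure) +
  assumes EE_epi: "e \<in> EE C \<Longrightarrow> is_epi C e"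
    and MM_mono: "m \<in> MM C \<Longrightarrow> is_mono C m"
    and iso_EE: "is_iso C f \<Longrightarrow> f \<in> EE C"
    and iso_MM: "is_iso C f \<Longrightarrow> f \<in> MM C"
    and EE_cmp: "\<lbrakk>e \<in> EE C; e' \<in> EE C; Cod C e = Dom C e'\<rbrakk> \<Longrightarrow> e' \<cdot> e \<in> EE C"
    and MM_cmp: "\<lbrakk>m \<in> MM C; m' \<in> MM C; Cod C m = Dom C m'\<rbrakk> \<Longrightarrow> m' \<cdot> m \<in> MM C"
    and factorization: "f \<in> Arr C \<Longrightarrow>
          \<exists>e \<in> EE C. \<exists>m \<in> MM C. Cod C e = Dom C m \<and> m \<cdot> e = f"
    and diagonal: "\<lbrakk>e \<in> EE C; m \<in> MM C; u \<in> Hom C (Dom C e) (Dom C m);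
                    v \<in> Hom C (Cod C e) (Cod C m); v \<cdot> e = m \<cdot> u\<rbrakk>
          \<Longrightarrow> \<exists>!d. d \<in> Hom C (Cod C e) (Dom C m) \<and> d \<cdot> e = u \<and> m \<cdot> d = v"

definition factors_through :: "('o, 'a, 'z) cat_scheme \<Rightarrow> 'a \<Rightarrow> 'a \<Rightarrow> bool" where
  "factors_through C m n \<longleftrightarrow> (\<exists>k \<in> Hom C (Dom C m) (Dom C n). n \<cdot>\<^bsub>C\<^esub> k = m)"

definition sub_rel :: "('o, 'a) fact_cat \<Rightarrow> 'o \<Rightarrow> ('a \<times> 'a) set" where
  "sub_rel C X = {(m, n). m \<in> MM C \<and> Cod C m = X \<and> n \<in> MM C \<and> Cod C n = X
                        \<and> factors_through C m n \<and> factors_through C n m}"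

definition Sub :: "('o, 'a) fact_cat \<Rightarrow> 'o \<Rightarrow> 'a set set" where
  "Sub C X = {m \<in> MM C. Cod C m = X} // sub_rel C X"

definition sub_class :: "('o, 'a) fact_cat \<Rightarrow> 'a \<Rightarrow> 'a set" where
  "sub_class C m = sub_rel C (Cod C m) `` {m}"

definition SubL :: "('o, 'a) fact_cat \<Rightarrow> 'o \<Rightarrow> 'a set gorder" where
  "SubL C X = \<lparr>carrier = Sub C X, eq = (=),
               le = (\<lambda>p q. \<exists>m \<in> p. \<exists>n \<in> q. factors_through C m n)\<rparr>"

locale fact_context = proper_factorization_system C
  for C :: "('o, 'a) fact_cat" (structure) +
  assumes finitely_complete: "finitely_complete C"
    and finite_coproducts: "has_finite_coproducts C"
    and Sub_complete: "X \<in> Obj C \<Longrightarrow> complete_lattice (SubL C X)"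

text \<open>\<open>M_parts C f\<close> collects the second components of all factorizations of \<open>f\<close>. As these are
  unique up to isomorphism, it is exactly one class in \<open>Sub C (Cod C f)\<close>. In the same way the
  unions in \<open>bot_sub\<close>, \<open>dimg\<close>, \<open>preimg\<close> and \<open>comp_sub\<close> below range over isomorphic
  choices (of initial object, representative, pullback), and each is a single class.\<close>

definition M_parts :: "('o, 'a) fact_cat \<Rightarrow> 'a \<Rightarrow> 'a set" where
  "M_parts C f = {m \<in> MM C. \<exists>e \<in> EE C. Cod C e = Dom C m \<and> m \<cdot>\<^bsub>C\<^esub> e = f}"

definition bot_sub :: "('o, 'a) fact_cat \<Rightarrow> 'o \<Rightarrow> 'a set" where
  "bot_sub C X = \<Union> {M_parts C i | i I. is_initial C I \<and> i \<in> Hom C I X}"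

definition dimg :: "('o, 'a) fact_cat \<Rightarrow> 'a \<Rightarrow> 'a set \<Rightarrow> 'a set" where
  "dimg C f p = (\<Union>m \<in> p. M_parts C (f \<cdot>\<^bsub>C\<^esub> m))"

definition preimg :: "('o, 'a) fact_cat \<Rightarrow> 'a \<Rightarrow> 'a set \<Rightarrow> 'a set" where
  "preimg C f q = {k. \<exists>n \<in> q. \<exists>h. is_pullback C f n k h}"

definition comp_sub :: "('o, 'a) fact_cat \<Rightarrow> 'a \<Rightarrow> 'a set \<Rightarrow> 'a set" where
  "comp_sub C m p = (\<Union>a \<in> p. sub_class C (m \<cdot>\<^bsub>C\<^esub> a))"

definition formally_surjective :: "('o, 'a) fact_cat \<Rightarrow> 'a \<Rightarrow> bool" where
  "formally_surjective C f \<longleftrightarrow> f \<in> Arr C \<and>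
     (\<forall>n \<in> MM C. \<forall>k h. Cod C n = Cod C f \<and> is_pullback C f n k h \<longrightarrow> h \<in> EE C)"


section \<open>Preneighbourhood systems\<close>

definition Fil :: "('o, 'a) fact_cat \<Rightarrow> 'o \<Rightarrow> 'a set set set" where
  "Fil C X = {F. F \<subseteq> Sub C X \<and> F \<noteq> {}
     \<and> (\<forall>p \<in> F. \<forall>q \<in> Sub C X. p \<sqsubseteq>\<^bsub>SubL C X\<^esub> q \<longrightarrow> q \<in> F)
     \<and> (\<forall>p \<in> F. \<forall>q \<in> F. p \<sqinter>\<^bsub>SubL C X\<^esub> q \<in> F)}"

definition preneighbourhood_system ::
  "('o, 'a) fact_cat \<Rightarrow> 'o \<Rightarrow> ('a set \<Rightarrow> 'a set set) \<Rightarrow> bool" where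
  "preneighbourhood_system C X \<mu> \<longleftrightarrow>
     (\<forall>m \<in> Sub C X. \<mu> m \<in> Fil C X)
   \<and> (\<forall>m \<in> Sub C X. \<forall>n \<in> Sub C X. m \<sqsubseteq>\<^bsub>SubL C X\<^esub> n \<longrightarrow> \<mu> n \<subseteq> \<mu> m)
   \<and> \<mu> (bot_sub C X) = Sub C X
   \<and> (\<forall>m \<in> Sub C X. \<forall>p \<in> \<mu> m. m \<sqsubseteq>\<^bsub>SubL C X\<^esub> p)"

definition preneighbourhood_space ::
  "('o, 'a) fact_cat \<Rightarrow> 'o \<Rightarrow> ('a set \<Rightarrow> 'a set set) \<Rightarrow> bool" where
  "preneighbourhood_space C X \<mu> \<longleftrightarrow> X \<in> Obj C \<and> preneighbourhood_system C X \<mu>"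

text \<open>The system induced on \<open>M = Dom C m\<close> by a system \<open>\<mu>\<close> on \<open>Cod C m\<close>.\<close>

definition restricted ::
  "('o, 'a) fact_cat \<Rightarrow> ('a set \<Rightarrow> 'a set set) \<Rightarrow> 'a \<Rightarrow> ('a set \<Rightarrow> 'a set set)" where
  "restricted C \<mu> m a = {u \<in> Sub C (Dom C m).
     \<exists>v \<in> \<mu> (comp_sub C m a). preimg C m v \<sqsubseteq>\<^bsub>SubL C (Dom C m)\<^esub> u}"

text \<open>An isomorphism of the underlying category between two spaces need not be closed: the identity
  of a two-point set from the discrete system (\<open>p \<in> \<mu> m\<close> iff \<open>m \<le> p\<close>) to the indiscrete one
  (\<open>\<mu> m = {X}\<close> unless \<open>m\<close> is least) is not. It is closed as soon as its inverse respects the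
  systems in the following sense.\<close>

definition preneighbourhood_morphism ::
  "('o, 'a) fact_cat \<Rightarrow> 'o \<Rightarrow> ('a set \<Rightarrow> 'a set set) \<Rightarrow> 'o \<Rightarrow> ('a set \<Rightarrow> 'a set set)
     \<Rightarrow> 'a \<Rightarrow> bool" where
  "preneighbourhood_morphism C X \<mu> Y \<phi> f \<longleftrightarrow> f \<in> Hom C X Y \<and>
     (\<forall>m \<in> Sub C Y. \<forall>p \<in> \<phi> m. preimg C f p \<in> \<mu> (preimg C f m))"


section \<open>Closure, closed and continuous morphisms\<close>

definition Far ::
  "('o, 'a) fact_cat \<Rightarrow> 'o \<Rightarrow> ('a set \<Rightarrow> 'a set set) \<Rightarrow> 'a set \<Rightarrow> 'a set set" where
  "Far C X \<mu> p = {x \<in> Sub C X. \<exists>u \<in> \<mu> x. u \<sqinter>\<^bsub>SubL C X\<^esub> p = bot_sub C X}"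

definition cl ::
  "('o, 'a) fact_cat \<Rightarrow> 'o \<Rightarrow> ('a set \<Rightarrow> 'a set set) \<Rightarrow> 'a set \<Rightarrow> 'a set" where
  "cl C X \<mu> p = \<Squnion>\<^bsub>SubL C X\<^esub> {x \<in> Sub C X. \<not> p \<sqsubset>\<^bsub>SubL C X\<^esub> x \<and> x \<notin> Far C X \<mu> p}"

definition closed_subs ::
  "('o, 'a) fact_cat \<Rightarrow> 'o \<Rightarrow> ('a set \<Rightarrow> 'a set set) \<Rightarrow> 'a set set" where
  "closed_subs C X \<mu> = {p \<in> Sub C X. cl C X \<mu> p = p}"

definition cl_hat ::
  "('o, 'a) fact_cat \<Rightarrow> 'o \<Rightarrow> ('a set \<Rightarrow> 'a set set) \<Rightarrow> 'a set \<Rightarrow> 'a set" where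
  "cl_hat C X \<mu> p = \<Sqinter>\<^bsub>SubL C X\<^esub> {t \<in> closed_subs C X \<mu>. p \<sqsubseteq>\<^bsub>SubL C X\<^esub> t}"

definition closed_morphism ::
  "('o, 'a) fact_cat \<Rightarrow> 'o \<Rightarrow> ('a set \<Rightarrow> 'a set set) \<Rightarrow> 'o \<Rightarrow> ('a set \<Rightarrow> 'a set set)
     \<Rightarrow> 'a \<Rightarrow> bool" where
  "closed_morphism C X \<mu> Y \<phi> f \<longleftrightarrow> f \<in> Hom C X Y \<and>
     (\<forall>p \<in> closed_subs C X \<mu>. dimg C f p \<in> closed_subs C Y \<phi>)"

definition continuous_morphism ::
  "('o, 'a) fact_cat \<Rightarrow> 'o \<Rightarrow> ('a set \<Rightarrow> 'a set set) \<Rightarrow> 'o \<Rightarrow> ('a set \<Rightarrow> 'a set set)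
     \<Rightarrow> 'a \<Rightarrow> bool" where
  "continuous_morphism C X \<mu> Y \<phi> f \<longleftrightarrow> f \<in> Hom C X Y \<and>
     (\<forall>t \<in> closed_subs C Y \<phi>. preimg C f t \<in> closed_subs C X \<mu>)"

end

theory Submission
  imports Defs
begin

text \<open>The proof rests on one reformulation, \<open>closed_subs_iff_comparable\<close>: a subobject \<open>p\<close> is closed
  iff every \<open>x\<close> that is not far from \<open>p\<close> is comparable with \<open>p\<close>. This condition refers only to the
  order and to disjointness, so it can be moved along anything that preserves these two.

  Being far from \<open>p\<close> is antitone in \<open>p\<close>, and therefore closed subobjects are stable under arbitrary
  meets (\<open>Inf_closed_subs\<close>). Hence \<open>cl_hat p\<close> is the least closed subobject above \<open>p\<close>, and the two
  characterizations of closed morphisms by \<open>cl_hat\<close> are formal consequences of this and of the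
  adjunction of \<open>\<exists>\<^sub>f\<close> and \<open>f\<^sup>-\<^sup>1\<close> (\<open>dimg_le_iff_le_preimg\<close>).

  For \<open>m\<close> in \<open>M\<close>, direct image identifies \<open>Sub M\<close> with the part of \<open>Sub X\<close> below \<open>m\<close>, and Frobenius
  reciprocity \<open>v \<and> \<exists>\<^sub>m p = \<exists>\<^sub>m (m\<^sup>-\<^sup>1 v \<and> p)\<close> shows that \<open>x\<close> is far from \<open>p\<close> in the subspace iff \<open>\<exists>\<^sub>m x\<close>
  is far from \<open>\<exists>\<^sub>m p\<close> in the whole space (\<open>Far_restricted_iff\<close>). So a subobject of \<open>M\<close> with closed
  image is closed in \<open>M\<close>, and the converse holds when \<open>m\<close> is closed, because then whatever is not far
  from \<open>m\<close> lies below \<open>m\<close>, and is seen by the subspace, or above it. This settles closed embeddings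
  and, with the pasting law \<open>f\<^sup>-\<^sup>1 (\<exists>\<^sub>m t) = \<exists>\<^sub>k (f\<^sub>m\<^sup>-\<^sup>1 t)\<close> for \<open>k = f\<^sup>-\<^sup>1 m\<close>, corestrictions.
  An isomorphism is in \<open>M\<close> as well, so the same reciprocity applies to it. Composites and
  cancellation only use \<open>\<exists>\<close> of a composite and \<open>\<exists>\<^sub>f (f\<^sup>-\<^sup>1 q) = q\<close> for formally surjective \<open>f\<close>.\<close>

section \<open>Pullbacks from finite limits\<close>

lemma (in category) Hom_iff: "f \<in> Hom C A B \<longleftrightarrow> f \<in> Arr C \<and> Dom C f = A \<and> Cod C f = B"
  by (simp add: Hom_def)

lemma (in category) cmp_typing:
  assumes "f \<in> Hom C A B" "g \<in> Hom C B D"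
  shows "g \<cdot> f \<in> Arr C" "Dom C (g \<cdot> f) = A" "Cod C (g \<cdot> f) = D"
  using cmp_in_Hom[OF assms] by (simp_all add: Hom_iff)

lemma (in category) is_pullbackD:
  assumes "is_pullback C f n k h"
  shows "f \<in> Hom C (Dom C f) (Cod C f)" "n \<in> Hom C (Dom C n) (Cod C f)"
    "k \<in> Hom C (Dom C k) (Dom C f)" "h \<in> Hom C (Dom C k) (Dom C n)" "f \<cdot> k = n \<cdot> h"
  using assms by (auto simp: is_pullback_def Hom_iff)

lemma (in category) is_pullbackI:
  assumes f: "f \<in> Hom C A B" and n: "n \<in> Hom C N B" and k: "k \<in> Hom C P A" and h: "h \<in> Hom C P N"
    and sq: "f \<cdot> k = n \<cdot> h"
    and univ: "\<And>Q a b. \<lbrakk>a \<in> Hom C Q A; b \<in> Hom C Q N; f \<cdot> a = n \<cdot> b\<rbrakk>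
      \<Longrightarrow> \<exists>!u. u \<in> Hom C Q P \<and> k \<cdot> u = a \<and> h \<cdot> u = b"
  shows "is_pullback C f n k h"
proof -
  have D: "f \<in> Arr C" "Dom C f = A" "Cod C f = B" "Dom C n = N" "Dom C k = P"
    using f n k by (simp_all add: Hom_iff)
  show ?thesis unfolding is_pullback_def D using D(1) n k h sq univ by blast
qed

lemma (in category) is_pullback_lift:
  assumes "is_pullback C f n k h" "a \<in> Hom C Q (Dom C f)" "b \<in> Hom C Q (Dom C n)" "f \<cdot> a = n \<cdot> b"
  obtains u where "u \<in> Hom C Q (Dom C k)" "k \<cdot> u = a" "h \<cdot> u = b"
  using assms unfolding is_pullback_def by metis

lemma (in category) is_pullback_unique:
  assumes pb: "is_pullback C f n k h" and u: "u \<in> Hom C Q (Dom C k)" and v: "v \<in> Hom C Q (Dom C k)"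
    and "k \<cdot> u = k \<cdot> v" "h \<cdot> u = h \<cdot> v"
  shows "u = v"
proof -
  note D = is_pullbackD[OF pb]
  have "f \<cdot> (k \<cdot> u) = n \<cdot> (h \<cdot> u)"
    using cmp_assoc[OF u D(3,1)] cmp_assoc[OF u D(4,2)] D(5) by simp
  then have "\<exists>!w. w \<in> Hom C Q (Dom C k) \<and> k \<cdot> w = k \<cdot> u \<and> h \<cdot> w = h \<cdot> u"
    using pb cmp_in_Hom[OF u D(3)] cmp_in_Hom[OF u D(4)] unfolding is_pullback_def by blast
  then show ?thesis using assms by metis
qed

text \<open>The shape \<open>0 \<rightarrow> 2 \<leftarrow> 1\<close>, whose limits are pullbacks; an object and its identity share a number.\<close>

definition cospan_shape :: "(nat, nat) cat" where
  "cospan_shape = \<lparr>Obj = {0, 1, 2}, Arr = {0, 1, 2, 3, 4},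
     Dom = (\<lambda>a. if a = 3 then 0 else if a = 4 then 1 else a),
     Cod = (\<lambda>a. if a = 3 \<or> a = 4 then 2 else a), Idt = (\<lambda>j. j),
     Cmp = (\<lambda>b a. if b = 3 \<or> b = 4 then b else a)\<rparr>"

lemma category_cospan_shape: "category cospan_shape"
  by unfold_locales (auto simp: cospan_shape_def Hom_def split: if_splits)

lemma (in category) pullback_exists:
  assumes fc: "finitely_complete C" and f: "f \<in> Hom C A B" and n: "n \<in> Hom C N B"
  shows "\<exists>k h. is_pullback C f n k h"
proof -
  define Fo where "Fo = (\<lambda>j::nat. if j = 0 then A else if j = 1 then N else B)"
  define Fa where "Fa = (\<lambda>a::nat. if a = 3 then f else if a = 4 then n else Idt C (Fo a))"
  have obj: "A \<in> Obj C" "N \<in> Obj C" "B \<in> Obj C"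
    using f n dom_in_Obj cod_in_Obj by (auto simp: Hom_iff)
  have "is_functor cospan_shape C Fo Fa"
    using f n obj idt_in_Hom[of A] idt_in_Hom[of N] idt_in_Hom[of B]
      idt_right[OF f] idt_left[OF f] idt_right[OF n] idt_left[OF n]
      idt_left[OF idt_in_Hom, of A] idt_left[OF idt_in_Hom, of N] idt_left[OF idt_in_Hom, of B]
    by (auto simp: is_functor_def cospan_shape_def Fo_def Fa_def)
  moreover have "finite (Obj cospan_shape)" "finite (Arr cospan_shape)"
    by (simp_all add: cospan_shape_def)
  ultimately obtain L \<pi> where lim: "is_limit cospan_shape C Fo Fa L \<pi>"
    using fc category_cospan_shape unfolding finitely_complete_def by blast
  then have cone: "is_cone cospan_shape C Fo Fa L \<pi>" by (simp add: is_limit_def)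
  have \<pi>: "\<pi> 0 \<in> Hom C L A" "\<pi> 1 \<in> Hom C L N" "f \<cdot> \<pi> 0 = \<pi> 2" "n \<cdot> \<pi> 1 = \<pi> 2"
    using cone by (auto simp: is_cone_def cospan_shape_def Fo_def Fa_def)
  have univ: "\<exists>!u. u \<in> Hom C Q L \<and> \<pi> 0 \<cdot> u = a \<and> \<pi> 1 \<cdot> u = b"
    if a: "a \<in> Hom C Q A" and b: "b \<in> Hom C Q N" and eq: "f \<cdot> a = n \<cdot> b" for Q a b
  proof -
    define \<pi>' where "\<pi>' = (\<lambda>j::nat. if j = 0 then a else if j = 1 then b else f \<cdot> a)"
    have fa: "f \<cdot> a \<in> Hom C Q B" by (rule cmp_in_Hom[OF a f])
    have "Q \<in> Obj C" using a dom_in_Obj by (auto simp: Hom_iff)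
    then have "is_cone cospan_shape C Fo Fa Q \<pi>'"
      using a b fa eq idt_left[OF a] idt_left[OF b] idt_left[OF fa]
      by (auto simp: is_cone_def cospan_shape_def Fo_def Fa_def \<pi>'_def)
    then have ex1: "\<exists>!u. u \<in> Hom C Q L \<and> (\<forall>j \<in> Obj cospan_shape. \<pi> j \<cdot> u = \<pi>' j)"
      using lim by (simp add: is_limit_def)
    have "\<pi> 2 \<cdot> u = f \<cdot> a" if "u \<in> Hom C Q L" "\<pi> 0 \<cdot> u = a" for u
      using cmp_assoc[OF that(1) \<pi>(1) f] that \<pi>(3) by simp
    then have "(u \<in> Hom C Q L \<and> (\<forall>j \<in> Obj cospan_shape. \<pi> j \<cdot> u = \<pi>' j))
      \<longleftrightarrow> (u \<in> Hom C Q L \<and> \<pi> 0 \<cdot> u = a \<and> \<pi> 1 \<cdot> u = b)" for u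
      by (auto simp: cospan_shape_def \<pi>'_def)
    then show ?thesis using ex1 by simp
  qed
  have "is_pullback C f n (\<pi> 0) (\<pi> 1)"
    by (rule is_pullbackI[OF f n \<pi>(1,2) _ univ]) (simp_all only: \<pi>(3,4))
  then show ?thesis by blast
qed


section \<open>Admissible subobjects as classes of \<open>M\<close>-morphisms\<close>

lemma (in category) factors_through_refl: "m \<in> Arr C \<Longrightarrow> factors_through C m m"
  unfolding factors_through_def
  by (meson Hom_iff dom_in_Obj idt_in_Hom idt_right)

lemma (in category) factors_through_trans:
  assumes "factors_through C m n" "factors_through C n k" "m \<in> Arr C" "n \<in> Arr C" "k \<in> Arr C"
    and "Cod C n = Cod C k"
  shows "factors_through C m k"
proof -
  obtain u v where u: "u \<in> Hom C (Dom C m) (Dom C n)" "n \<cdot> u = m"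
    and v: "v \<in> Hom C (Dom C n) (Dom C k)" "k \<cdot> v = n"
    using assms unfolding factors_through_def by blast
  have "k \<in> Hom C (Dom C k) (Cod C k)" using assms by (simp add: Hom_iff)
  then have "k \<cdot> (v \<cdot> u) = m" using cmp_assoc[OF u(1) v(1)] u v by metis
  then show ?thesis unfolding factors_through_def using cmp_in_Hom[OF u(1) v(1)] by blast
qed

lemma (in category) inverse_arrowsD:
  assumes "inverse_arrows C i j"
  shows "i \<in> Hom C (Dom C i) (Cod C i)" "j \<in> Hom C (Cod C i) (Dom C i)"
    "j \<cdot> i = Idt C (Dom C i)" "i \<cdot> j = Idt C (Cod C i)"
  using assms by (auto simp: inverse_arrows_def Hom_iff)

lemma (in category) inverse_arrows_sym: "inverse_arrows C i j \<Longrightarrow> inverse_arrows C j i"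
  by (auto simp: inverse_arrows_def Hom_iff)

context proper_factorization_system
begin

lemma MM_Hom: "m \<in> MM C \<Longrightarrow> m \<in> Hom C (Dom C m) (Cod C m)"
  using MM_mono by (auto simp: is_mono_def Hom_iff)

lemma EE_Hom: "e \<in> EE C \<Longrightarrow> e \<in> Hom C (Dom C e) (Cod C e)"
  using EE_epi by (auto simp: is_epi_def Hom_iff)

lemma MM_cancel:
  "\<lbrakk>m \<in> MM C; u \<in> Hom C W (Dom C m); v \<in> Hom C W (Dom C m); m \<cdot> u = m \<cdot> v\<rbrakk> \<Longrightarrow> u = v"
  using MM_mono by (auto simp: is_mono_def)

lemma Idt_iso: "A \<in> Obj C \<Longrightarrow> is_iso C (Idt C A)"
  unfolding is_iso_def inverse_arrows_def
  using idt_in_Hom[of A] idt_left[of "Idt C A" A A] by (auto simp: Hom_iff)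

lemma factorize:
  assumes "f \<in> Hom C A B"
  obtains e m where "e \<in> EE C" "m \<in> MM C" "e \<in> Hom C A (Dom C m)" "m \<in> Hom C (Dom C m) B" "m \<cdot> e = f"
proof -
  obtain e m where em: "e \<in> EE C" "m \<in> MM C" "Cod C e = Dom C m" "m \<cdot> e = f"
    using factorization[of f] assms unfolding Hom_iff by blast
  have eH: "e \<in> Hom C (Dom C e) (Dom C m)" using EE_Hom[OF em(1)] em(3) by simp
  have D: "Dom C e = A" "Cod C m = B"
    using cmp_typing[OF eH MM_Hom[OF em(2)]] em(4) assms by (simp_all add: Hom_iff)
  show ?thesis
    by (rule that[OF em(1,2) eH[unfolded D] MM_Hom[OF em(2), unfolded D] em(4)])
qed

text \<open>The diagonal of the square \<open>m \<cdot> e = n \<cdot> u\<close> is the factorization; \<open>M\<close>-parts are compared in this way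
  throughout.\<close>

lemma factors_through_diagonal:
  assumes e: "e \<in> EE C" and n: "n \<in> MM C" and m: "m \<in> Hom C (Cod C e) (Cod C n)"
    and u: "u \<in> Hom C (Dom C e) (Dom C n)" and eq: "m \<cdot> e = n \<cdot> u"
  shows "factors_through C m n"
proof -
  have "Dom C m = Cod C e" using m by (simp add: Hom_iff)
  then show ?thesis using ex1_implies_ex[OF diagonal[OF e n u m eq]] unfolding factors_through_def by auto
qed

lemma mem_sub_class:
  "m \<in> MM C \<Longrightarrow> n \<in> sub_class C m \<longleftrightarrow>
     n \<in> MM C \<and> Cod C n = Cod C m \<and> factors_through C m n \<and> factors_through C n m"
  by (auto simp: sub_class_def sub_rel_def)

lemma self_in_sub_class: "m \<in> MM C \<Longrightarrow> m \<in> sub_class C m"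
  using MM_Hom by (simp add: mem_sub_class factors_through_refl Hom_iff)

lemma MM_factors_trans:
  "\<lbrakk>factors_through C m n; factors_through C n k; m \<in> MM C; n \<in> MM C; k \<in> MM C; Cod C n = Cod C k\<rbrakk>
    \<Longrightarrow> factors_through C m k"
  using factors_through_trans MM_Hom by (meson Hom_iff)

lemma sub_class_eqI:
  assumes "m \<in> MM C" "n \<in> MM C" "Cod C m = Cod C n" "factors_through C m n" "factors_through C n m"
  shows "sub_class C m = sub_class C n"
proof -
  have "sub_class C a \<subseteq> sub_class C b"
    if a: "a \<in> MM C" and b: "b \<in> MM C" and cod: "Cod C a = Cod C b"
      and ab: "factors_through C a b" "factors_through C b a" for a b
  proof
    fix k assume "k \<in> sub_class C a"
    then have k: "k \<in> MM C" "Cod C k = Cod C b" "factors_through C a k" "factors_through C k a"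
      using cod by (simp_all add: mem_sub_class[OF a])
    show "k \<in> sub_class C b"
      using k(1,2) MM_factors_trans[OF ab(2) k(3) b a k(1)] MM_factors_trans[OF k(4) ab(1) k(1) a b] cod
      by (simp add: mem_sub_class[OF b])
  qed
  then show ?thesis using assms by (metis subset_antisym)
qed

lemma sub_class_le_iff:
  assumes m: "m \<in> MM C" and n: "n \<in> MM C" and "Cod C m = X" "Cod C n = X"
  shows "sub_class C m \<sqsubseteq>\<^bsub>SubL C X\<^esub> sub_class C n \<longleftrightarrow> factors_through C m n"
proof
  assume "sub_class C m \<sqsubseteq>\<^bsub>SubL C X\<^esub> sub_class C n"
  then obtain m' n' where *: "m' \<in> sub_class C m" "n' \<in> sub_class C n" "factors_through C m' n'"
    by (auto simp: SubL_def)
  then have M: "m' \<in> MM C" "n' \<in> MM C" "Cod C m' = X" "Cod C n' = X"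
    and F: "factors_through C m m'" "factors_through C n' n"
    using assms by (auto simp: mem_sub_class)
  from MM_factors_trans[OF *(3) F(2)] M n assms have "factors_through C m' n" by simp
  from MM_factors_trans[OF F(1) this] M m n assms show "factors_through C m n" by simp
next
  assume "factors_through C m n"
  then show "sub_class C m \<sqsubseteq>\<^bsub>SubL C X\<^esub> sub_class C n"
    using self_in_sub_class m n by (auto simp: SubL_def)
qed

lemma Sub_eq: "Sub C X = sub_class C ` {m \<in> MM C. Cod C m = X}"
  by (auto simp: Sub_def quotient_def sub_class_def)

lemma sub_class_in_Sub: "m \<in> MM C \<Longrightarrow> Cod C m = X \<Longrightarrow> sub_class C m \<in> Sub C X"
  by (auto simp: Sub_eq)

lemma SubE:
  assumes "p \<in> Sub C X"
  obtains m where "m \<in> MM C" "Cod C m = X" "p = sub_class C m"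
  using assms by (auto simp: Sub_eq)

lemma sub_class_iso:
  assumes m: "m \<in> MM C" and n: "n \<in> sub_class C m"
  obtains i j where "inverse_arrows C i j" "i \<in> Hom C (Dom C n) (Dom C m)" "m \<cdot> i = n"
    "j \<in> Hom C (Dom C m) (Dom C n)" "n \<cdot> j = m"
proof -
  have nM: "n \<in> MM C" and ff: "factors_through C n m" "factors_through C m n"
    using n by (auto simp: mem_sub_class[OF m])
  then obtain i j where i: "i \<in> Hom C (Dom C n) (Dom C m)" "m \<cdot> i = n"
    and j: "j \<in> Hom C (Dom C m) (Dom C n)" "n \<cdot> j = m"
    unfolding factors_through_def by blast
  have mH: "m \<in> Hom C (Dom C m) (Cod C m)" and nH: "n \<in> Hom C (Dom C n) (Cod C n)"
    using MM_Hom m nM by auto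
  have obj: "Dom C m \<in> Obj C" "Dom C n \<in> Obj C" using mH nH dom_in_Obj by (auto simp: Hom_iff)
  have "m \<cdot> (i \<cdot> j) = m \<cdot> Idt C (Dom C m)"
    using cmp_assoc[OF j(1) i(1) mH] i j idt_right[OF mH] by simp
  then have ij: "i \<cdot> j = Idt C (Dom C m)"
    using MM_cancel[OF m cmp_in_Hom[OF j(1) i(1)] idt_in_Hom] obj by blast
  have "n \<cdot> (j \<cdot> i) = n \<cdot> Idt C (Dom C n)"
    using cmp_assoc[OF i(1) j(1) nH] i j idt_right[OF nH] by simp
  then have ji: "j \<cdot> i = Idt C (Dom C n)"
    using MM_cancel[OF nM cmp_in_Hom[OF i(1) j(1)] idt_in_Hom] obj by blast
  have "inverse_arrows C i j"
    using i j ij ji by (auto simp: inverse_arrows_def Hom_iff)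
  with that i j show ?thesis by blast
qed

lemma M_parts_eq:
  assumes e: "e \<in> EE C" and m: "m \<in> MM C" and ce: "Cod C e = Dom C m"
  shows "M_parts C (m \<cdot> e) = sub_class C m"
proof (intro equalityI subsetI)
  note mH = MM_Hom[OF m] and eH = EE_Hom[OF e, unfolded ce]
  fix n assume "n \<in> M_parts C (m \<cdot> e)"
  then obtain e' where n: "n \<in> MM C" and e': "e' \<in> EE C" "Cod C e' = Dom C n" "n \<cdot> e' = m \<cdot> e"
    by (auto simp: M_parts_def)
  note nH = MM_Hom[OF n] and eH' = EE_Hom[OF e'(1), unfolded e'(2)]
  have D: "Dom C e' = Dom C e" "Cod C n = Cod C m"
    using cmp_typing[OF eH mH] cmp_typing[OF eH' nH] e'(3) by auto
  have "factors_through C m n" "factors_through C n m"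
    using factors_through_diagonal[OF e n, of m e'] factors_through_diagonal[OF e'(1) m, of n e]
      mH nH eH eH' e' D ce by simp_all
  with n D m show "n \<in> sub_class C m" by (simp add: mem_sub_class)
next
  fix n assume n: "n \<in> sub_class C m"
  then have nM: "n \<in> MM C" by (simp add: mem_sub_class m)
  obtain i j where ij: "inverse_arrows C i j" "j \<in> Hom C (Dom C m) (Dom C n)" "n \<cdot> j = m"
    using sub_class_iso[OF m n] by metis
  have "j \<in> EE C" using inverse_arrows_sym[OF ij(1)] iso_EE by (auto simp: is_iso_def)
  then have je: "j \<cdot> e \<in> EE C" using EE_cmp[OF e] ce ij(2) by (auto simp: Hom_iff)
  have eH: "e \<in> Hom C (Dom C e) (Dom C m)" using EE_Hom[OF e] ce by simp
  have "n \<cdot> (j \<cdot> e) = m \<cdot> e" "Cod C (j \<cdot> e) = Dom C n"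
    using cmp_assoc[OF eH ij(2) MM_Hom[OF nM]] ij(3) cmp_typing[OF eH ij(2)] by auto
  then show "n \<in> M_parts C (m \<cdot> e)" using nM je by (auto simp: M_parts_def)
qed

lemma dimg_sub_class:
  assumes f: "f \<in> Hom C A B" and m: "m \<in> MM C" "Cod C m = A"
    and e: "e \<in> EE C" and n: "n \<in> MM C" and ce: "Cod C e = Dom C n" and eq: "f \<cdot> m = n \<cdot> e"
  shows "dimg C f (sub_class C m) = sub_class C n"
proof -
  have "M_parts C (f \<cdot> m') = sub_class C n" if m': "m' \<in> sub_class C m" for m'
  proof -
    obtain i j where i: "inverse_arrows C i j" "i \<in> Hom C (Dom C m') (Dom C m)" "m \<cdot> i = m'"
      using sub_class_iso[OF m(1) m'] by metis
    have mH: "m \<in> Hom C (Dom C m) A" using MM_Hom[OF m(1)] m(2) by simp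
    have eH: "e \<in> Hom C (Dom C e) (Dom C n)" using EE_Hom[OF e] ce by simp
    have de: "Dom C e = Dom C m"
      using cmp_typing[OF mH f] cmp_typing[OF eH MM_Hom[OF n]] eq by simp
    have "f \<cdot> m' = (f \<cdot> m) \<cdot> i" using cmp_assoc[OF i(2) mH f] i(3) by simp
    also have "\<dots> = n \<cdot> (e \<cdot> i)" unfolding eq
      by (rule cmp_assoc[OF _ eH MM_Hom[OF n]]) (use i(2) de in simp)
    finally have "f \<cdot> m' = n \<cdot> (e \<cdot> i)" .
    moreover have "i \<in> EE C" using i(1) iso_EE by (auto simp: is_iso_def)
    then have "e \<cdot> i \<in> EE C" using EE_cmp[OF _ e] i(2) de by (auto simp: Hom_iff)
    moreover have "Cod C (e \<cdot> i) = Dom C n" using cmp_typing(3)[of i "Dom C m'" "Dom C m" e] i(2) eH de by simp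
    ultimately show ?thesis using M_parts_eq n by simp
  qed
  then show ?thesis using self_in_sub_class[OF m(1)] unfolding dimg_def by blast
qed

text \<open>Composing with an \<open>M\<close>-morphism leaves nothing to factor.\<close>

lemma dimg_MM_sub_class:
  assumes m: "m \<in> MM C" and a: "a \<in> MM C" "Cod C a = Dom C m"
  shows "dimg C m (sub_class C a) = sub_class C (m \<cdot> a)"
proof -
  have aH: "a \<in> Hom C (Dom C a) (Dom C m)" using MM_Hom[OF a(1)] a(2) by simp
  have ma: "m \<cdot> a \<in> MM C" using MM_cmp[OF a(1) m] a(2) by simp
  have mH: "m \<cdot> a \<in> Hom C (Dom C a) (Cod C m)" by (rule cmp_in_Hom[OF aH MM_Hom[OF m]])
  have A: "Dom C a \<in> Obj C" using aH dom_in_Obj by (auto simp: Hom_iff)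
  show ?thesis
    using dimg_sub_class[OF MM_Hom[OF m] a, of "Idt C (Dom C a)" "m \<cdot> a"] ma mH A
      iso_EE[OF Idt_iso[OF A]] idt_in_Hom[OF A] idt_right[OF mH] by (simp add: Hom_iff)
qed

lemma comp_sub_eq_dimg:
  assumes m: "m \<in> MM C" and p: "p \<in> Sub C (Dom C m)"
  shows "comp_sub C m p = dimg C m p"
proof -
  obtain a where a: "a \<in> MM C" "Cod C a = Dom C m" "p = sub_class C a" by (rule SubE[OF p])
  have "sub_class C (m \<cdot> b) = sub_class C (m \<cdot> a)" if "b \<in> sub_class C a" for b
  proof -
    have b: "b \<in> MM C" "Cod C b = Dom C m" using that a by (auto simp: mem_sub_class)
    have "sub_class C b = sub_class C a"
      using that a sub_class_eqI[of b a] by (auto simp: mem_sub_class)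
    then show ?thesis using dimg_MM_sub_class[OF m] a b by metis
  qed
  then have "comp_sub C m p = sub_class C (m \<cdot> a)"
    unfolding comp_sub_def a(3) using self_in_sub_class[OF a(1)] by blast
  then show ?thesis using dimg_MM_sub_class[OF m a(1,2)] a(3) by simp
qed

text \<open>Factor the pulled back morphism as \<open>k = m' \<cdot> e\<close>. The diagonal of the square formed by \<open>e\<close> and
  \<open>n\<close> makes \<open>m'\<close> the first leg of a cone, and the induced arrow is inverse to \<open>e\<close>.\<close>

lemma MM_pullback_stable:
  assumes pb: "is_pullback C f n k h" and n: "n \<in> MM C"
  shows "k \<in> MM C"
proof -
  note D = is_pullbackD[OF pb]
  obtain e m where em: "e \<in> EE C" "m \<in> MM C" "e \<in> Hom C (Dom C k) (Dom C m)"
    "m \<in> Hom C (Dom C m) (Dom C f)" "m \<cdot> e = k"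
    by (rule factorize[OF D(3)])
  have fm: "f \<cdot> m \<in> Hom C (Dom C m) (Cod C f)" by (rule cmp_in_Hom[OF em(4) D(1)])
  have sq: "(f \<cdot> m) \<cdot> e = n \<cdot> h" using cmp_assoc[OF em(3,4) D(1)] em(5) D(5) by simp
  have ty: "Dom C e = Dom C k" "Cod C e = Dom C m" "Cod C n = Cod C f"
    using em(3) D(2) by (simp_all add: Hom_iff)
  obtain d where d: "d \<in> Hom C (Dom C m) (Dom C n)" "d \<cdot> e = h" "n \<cdot> d = f \<cdot> m"
    using diagonal[OF em(1) n, unfolded ty, OF D(4) fm sq] by blast
  obtain u where u: "u \<in> Hom C (Dom C m) (Dom C k)" "k \<cdot> u = m" "h \<cdot> u = d"
    using is_pullback_lift[OF pb em(4) d(1) d(3)[symmetric]] by blast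
  have ue: "u \<cdot> e \<in> Hom C (Dom C k) (Dom C k)" by (rule cmp_in_Hom[OF em(3) u(1)])
  have obj: "Dom C k \<in> Obj C" "Dom C m \<in> Obj C" using D(3) em(4) dom_in_Obj by (auto simp: Hom_iff)
  have 1: "u \<cdot> e = Idt C (Dom C k)"
  proof (rule is_pullback_unique[OF pb ue idt_in_Hom[OF obj(1)]])
    show "k \<cdot> u \<cdot> e = k \<cdot> Idt C (Dom C k)"
      using cmp_assoc[OF em(3) u(1) D(3)] u(2) em(5) idt_right[OF D(3)] by simp
    show "h \<cdot> u \<cdot> e = h \<cdot> Idt C (Dom C k)"
      using cmp_assoc[OF em(3) u(1) D(4)] u(3) d(2) idt_right[OF D(4)] by simp
  qed
  have "m \<cdot> (e \<cdot> u) = m \<cdot> Idt C (Dom C m)"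
    using cmp_assoc[OF u(1) em(3,4)] u(2) em(5) idt_right[OF em(4)] by simp
  then have 2: "e \<cdot> u = Idt C (Dom C m)"
    using MM_cancel[OF em(2) cmp_in_Hom[OF u(1) em(3)] idt_in_Hom[OF obj(2)]] by blast
  have "is_iso C e"
    unfolding is_iso_def inverse_arrows_def using em(3) u(1) 1 2 by (auto simp: Hom_iff)
  then have "e \<in> MM C" by (rule iso_MM)
  then have "m \<cdot> e \<in> MM C" using MM_cmp em(2,3) by (auto simp: Hom_iff)
  then show ?thesis using em(5) by simp
qed

lemma preimg_sub_class:
  assumes pb: "is_pullback C f n k h" and n: "n \<in> MM C"
  shows "preimg C f (sub_class C n) = sub_class C k"
proof (intro equalityI subsetI)
  note D = is_pullbackD[OF pb] and k = MM_pullback_stable[OF pb n]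
  fix k' assume "k' \<in> preimg C f (sub_class C n)"
  then obtain n' h' where n': "n' \<in> sub_class C n" and pb': "is_pullback C f n' k' h'"
    by (auto simp: preimg_def)
  have n'M: "n' \<in> MM C" using n' n by (simp add: mem_sub_class)
  note D' = is_pullbackD[OF pb'] and k' = MM_pullback_stable[OF pb' n'M]
  obtain i j where ij: "i \<in> Hom C (Dom C n') (Dom C n)" "n \<cdot> i = n'"
    "j \<in> Hom C (Dom C n) (Dom C n')" "n' \<cdot> j = n"
    using sub_class_iso[OF n n'] by metis
  have "f \<cdot> k' = n \<cdot> (i \<cdot> h')" using D'(5) cmp_assoc[OF D'(4) ij(1) D(2)] ij(2) by simp
  from is_pullback_lift[OF pb D'(3) cmp_in_Hom[OF D'(4) ij(1)] this]
  have 1: "factors_through C k' k" unfolding factors_through_def by blast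
  have "f \<cdot> k = n' \<cdot> (j \<cdot> h)" using D(5) cmp_assoc[OF D(4) ij(3) D'(2)] ij(4) by simp
  from is_pullback_lift[OF pb' D(3) cmp_in_Hom[OF D(4) ij(3)] this]
  have 2: "factors_through C k k'" unfolding factors_through_def by blast
  show "k' \<in> sub_class C k"
    using 1 2 k k' D(3) D'(3) by (auto simp: mem_sub_class Hom_iff)
next
  note D = is_pullbackD[OF pb] and k = MM_pullback_stable[OF pb n]
  fix k' assume k': "k' \<in> sub_class C k"
  obtain i j where ij: "inverse_arrows C i j" "i \<in> Hom C (Dom C k') (Dom C k)" "k \<cdot> i = k'"
    "j \<in> Hom C (Dom C k) (Dom C k')" "k' \<cdot> j = k"
    using sub_class_iso[OF k k'] by metis
  have k'M: "k' \<in> MM C" and k'H: "k' \<in> Hom C (Dom C k') (Dom C f)"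
    using k' k D(3) MM_Hom by (auto simp: mem_sub_class Hom_iff)
  have hi: "h \<cdot> i \<in> Hom C (Dom C k') (Dom C n)" by (rule cmp_in_Hom[OF ij(2) D(4)])
  have sq: "f \<cdot> k' = n \<cdot> (h \<cdot> i)"
    using cmp_assoc[OF ij(2) D(3,1)] cmp_assoc[OF ij(2) D(4,2)] D(5) ij(3) by simp
  have "\<exists>!u. u \<in> Hom C Q (Dom C k') \<and> k' \<cdot> u = a \<and> (h \<cdot> i) \<cdot> u = b"
    if a: "a \<in> Hom C Q (Dom C f)" and b: "b \<in> Hom C Q (Dom C n)" and eq: "f \<cdot> a = n \<cdot> b" for Q a b
  proof -
    obtain u where u: "u \<in> Hom C Q (Dom C k)" "k \<cdot> u = a" "h \<cdot> u = b"
      by (rule is_pullback_lift[OF pb a b eq])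
    have iju: "i \<cdot> (j \<cdot> u) = u"
      using cmp_assoc[OF u(1) ij(4,2)] inverse_arrowsD(4)[OF ij(1)] ij(2) idt_left[OF u(1)]
      by (auto simp: Hom_iff)
    have ju: "j \<cdot> u \<in> Hom C Q (Dom C k')" by (rule cmp_in_Hom[OF u(1) ij(4)])
    have "k' \<cdot> (j \<cdot> u) = a" using cmp_assoc[OF u(1) ij(4) k'H] ij(5) u(2) by simp
    moreover have "(h \<cdot> i) \<cdot> (j \<cdot> u) = b" using cmp_assoc[OF ju ij(2) D(4)] iju u(3) by simp
    ultimately show ?thesis using ju MM_cancel[OF k'M] by metis
  qed
  then have "is_pullback C f n k' (h \<cdot> i)"
    by (rule is_pullbackI[OF D(1,2) k'H hi sq])
  then show "k' \<in> preimg C f (sub_class C n)"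
    using self_in_sub_class[OF n] by (auto simp: preimg_def)
qed

end


section \<open>The adjunction between direct and inverse images\<close>

context fact_context
begin

lemma Sub_le_refl:
  assumes "p \<in> Sub C X"
  shows "p \<sqsubseteq>\<^bsub>SubL C X\<^esub> p"
proof -
  obtain m where m: "m \<in> MM C" "Cod C m = X" "p = sub_class C m" by (rule SubE[OF assms])
  have "m \<in> Arr C" using MM_Hom[OF m(1)] by (simp add: Hom_iff)
  then show ?thesis using factors_through_refl sub_class_le_iff[OF m(1,1,2,2)] m(3) by simp
qed

lemma Sub_le_trans:
  assumes "p \<sqsubseteq>\<^bsub>SubL C X\<^esub> q" "q \<sqsubseteq>\<^bsub>SubL C X\<^esub> r" "p \<in> Sub C X" "q \<in> Sub C X" "r \<in> Sub C X"
  shows "p \<sqsubseteq>\<^bsub>SubL C X\<^esub> r"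
proof -
  obtain a where a: "a \<in> MM C" "Cod C a = X" "p = sub_class C a" by (rule SubE[OF assms(3)])
  obtain b where b: "b \<in> MM C" "Cod C b = X" "q = sub_class C b" by (rule SubE[OF assms(4)])
  obtain c where c: "c \<in> MM C" "Cod C c = X" "r = sub_class C c" by (rule SubE[OF assms(5)])
  have "factors_through C a b" "factors_through C b c"
    using assms(1,2) sub_class_le_iff[OF a(1) b(1) a(2) b(2)] sub_class_le_iff[OF b(1) c(1) b(2) c(2)]
    by (simp_all add: a(3) b(3) c(3))
  then show ?thesis
    using MM_factors_trans[of a b c] sub_class_le_iff[OF a(1) c(1) a(2) c(2)] a b c by simp
qed

lemma Sub_le_antisym:
  assumes "p \<sqsubseteq>\<^bsub>SubL C X\<^esub> q" "q \<sqsubseteq>\<^bsub>SubL C X\<^esub> p" "p \<in> Sub C X" "q \<in> Sub C X"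
  shows "p = q"
proof -
  obtain a where a: "a \<in> MM C" "Cod C a = X" "p = sub_class C a" by (rule SubE[OF assms(3)])
  obtain b where b: "b \<in> MM C" "Cod C b = X" "q = sub_class C b" by (rule SubE[OF assms(4)])
  have "factors_through C a b" "factors_through C b a"
    using assms(1,2) sub_class_le_iff[OF a(1) b(1) a(2) b(2)] sub_class_le_iff[OF b(1) a(1) b(2) a(2)]
    by (simp_all add: a(3) b(3))
  then show ?thesis using sub_class_eqI[OF a(1) b(1)] a b by simp
qed

lemma MM_Obj: "m \<in> MM C \<Longrightarrow> Dom C m \<in> Obj C" "m \<in> MM C \<Longrightarrow> Cod C m \<in> Obj C"
  using MM_Hom dom_in_Obj cod_in_Obj by (auto simp: Hom_iff)

lemma Idt_MM: "A \<in> Obj C \<Longrightarrow> Idt C A \<in> MM C \<and> Cod C (Idt C A) = A \<and> Dom C (Idt C A) = A"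
  using iso_MM[OF Idt_iso] idt_in_Hom by (auto simp: Hom_iff)

lemma top_in_Sub: "X \<in> Obj C \<Longrightarrow> sub_class C (Idt C X) \<in> Sub C X"
  using Idt_MM sub_class_in_Sub by blast

lemma le_top:
  assumes X: "X \<in> Obj C" and p: "p \<in> Sub C X"
  shows "p \<sqsubseteq>\<^bsub>SubL C X\<^esub> sub_class C (Idt C X)"
proof -
  obtain m where m: "m \<in> MM C" "Cod C m = X" "p = sub_class C m" by (rule SubE[OF p])
  have mH: "m \<in> Hom C (Dom C m) X" using MM_Hom[OF m(1)] m(2) by simp
  have "factors_through C m (Idt C X)"
    unfolding factors_through_def using mH idt_left[OF mH] Idt_MM[OF X] by auto
  then show ?thesis using sub_class_le_iff[OF m(1) _ m(2), of "Idt C X"] Idt_MM[OF X] m(3) by simp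
qed

lemma bot_in_Sub_least:
  assumes X: "X \<in> Obj C"
  shows "bot_sub C X \<in> Sub C X" and "p \<in> Sub C X \<Longrightarrow> bot_sub C X \<sqsubseteq>\<^bsub>SubL C X\<^esub> p"
proof -
  \<comment> \<open>A coproduct of the empty family is an initial object.\<close>
  obtain I :: 'o and \<iota> :: "nat \<Rightarrow> 'a" where "is_coproduct C {} (\<lambda>_. X) I \<iota>"
    using finite_coproducts[unfolded has_finite_coproducts_def, rule_format, of "{}" "\<lambda>_. X"] by auto
  then have init: "is_initial C I"
    by (auto simp: is_coproduct_def is_initial_def)
  then obtain i where i: "i \<in> Hom C I X" using X by (auto simp: is_initial_def)
  obtain e s where es: "e \<in> EE C" "s \<in> MM C" "e \<in> Hom C I (Dom C s)" "s \<in> Hom C (Dom C s) X" "s \<cdot> e = i"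
    by (rule factorize[OF i])
  have le: "factors_through C s n"
    if J: "is_initial C J" and e: "e \<in> EE C" "e \<in> Hom C J (Dom C s)" and s: "s \<in> Hom C (Dom C s) X"
      and n: "n \<in> MM C" "Cod C n = X" for J e s n
  proof -
    obtain j where j: "j \<in> Hom C J (Dom C n)" using J MM_Obj[OF n(1)] by (auto simp: is_initial_def)
    have "s \<cdot> e \<in> Hom C J X" "n \<cdot> j \<in> Hom C J X"
      using cmp_in_Hom[OF e(2) s] cmp_in_Hom[OF j MM_Hom[OF n(1)]] n(2) by auto
    then have "s \<cdot> e = n \<cdot> j" using J X unfolding is_initial_def by blast
    then show ?thesis
      using factors_through_diagonal[OF e(1) n(1), of s j] e s j n by (auto simp: Hom_iff)
  qed
  have "M_parts C i' = sub_class C s" if J: "is_initial C J" and i': "i' \<in> Hom C J X" for J i'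
  proof -
    obtain e' s' where es': "e' \<in> EE C" "s' \<in> MM C" "e' \<in> Hom C J (Dom C s')"
      "s' \<in> Hom C (Dom C s') X" "s' \<cdot> e' = i'"
      by (rule factorize[OF i'])
    have "M_parts C i' = sub_class C s'" using M_parts_eq[OF es'(1,2)] es' by (auto simp: Hom_iff)
    moreover have "factors_through C s s'" "factors_through C s' s"
      using le[OF init es(1,3,4)] le[OF J es'(1,3,4)] es es' by (auto simp: Hom_iff)
    ultimately show ?thesis using sub_class_eqI[of s' s] es es' by (auto simp: Hom_iff)
  qed
  then have bot: "bot_sub C X = sub_class C s"
    unfolding bot_sub_def using init i by (intro equalityI subsetI) blast+
  then show "bot_sub C X \<in> Sub C X" using es sub_class_in_Sub by (auto simp: Hom_iff)
  show "bot_sub C X \<sqsubseteq>\<^bsub>SubL C X\<^esub> p" if p: "p \<in> Sub C X"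
  proof -
    obtain n where n: "n \<in> MM C" "Cod C n = X" "p = sub_class C n" by (rule SubE[OF p])
    then show ?thesis using le[OF init es(1,3,4)] es bot by (auto simp: sub_class_le_iff Hom_iff)
  qed
qed

lemma Sub_less_iff: "p \<sqsubset>\<^bsub>SubL C X\<^esub> q \<longleftrightarrow> p \<sqsubseteq>\<^bsub>SubL C X\<^esub> q \<and> p \<noteq> q"
  by (simp add: lless_def SubL_def)

lemma eq_bot_iff:
  "X \<in> Obj C \<Longrightarrow> p \<in> Sub C X \<Longrightarrow> p = bot_sub C X \<longleftrightarrow> p \<sqsubseteq>\<^bsub>SubL C X\<^esub> bot_sub C X"
  using bot_in_Sub_least Sub_le_antisym Sub_le_refl by metis

lemma dimg_in_Sub:
  assumes f: "f \<in> Hom C A B" and p: "p \<in> Sub C A"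
  shows "dimg C f p \<in> Sub C B"
proof -
  obtain m where m: "m \<in> MM C" "Cod C m = A" "p = sub_class C m" by (rule SubE[OF p])
  have mH: "m \<in> Hom C (Dom C m) A" using MM_Hom m by auto
  obtain e n where en: "e \<in> EE C" "n \<in> MM C" "e \<in> Hom C (Dom C m) (Dom C n)"
    "n \<in> Hom C (Dom C n) B" "n \<cdot> e = f \<cdot> m"
    by (rule factorize[OF cmp_in_Hom[OF mH f]])
  then have "dimg C f p = sub_class C n" using dimg_sub_class[OF f m(1,2)] m(3) by (auto simp: Hom_iff)
  then show ?thesis using en sub_class_in_Sub by (auto simp: Hom_iff)
qed

lemma preimgE:
  assumes f: "f \<in> Hom C A B" and q: "q \<in> Sub C B"
  obtains n k h where "n \<in> MM C" "Cod C n = B" "q = sub_class C n" "is_pullback C f n k h"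
    "k \<in> MM C" "Cod C k = A" "preimg C f q = sub_class C k"
proof -
  obtain n where n: "n \<in> MM C" "Cod C n = B" "q = sub_class C n" by (rule SubE[OF q])
  have "n \<in> Hom C (Dom C n) B" using MM_Hom n by auto
  then obtain k h where pb: "is_pullback C f n k h" using pullback_exists[OF finitely_complete f] by blast
  have "Cod C k = A" using is_pullbackD(3)[OF pb] f by (auto simp: Hom_iff)
  with that[OF n pb MM_pullback_stable[OF pb n(1)]] preimg_sub_class[OF pb n(1)] n(3) show ?thesis by simp
qed

lemma preimg_in_Sub: "f \<in> Hom C A B \<Longrightarrow> q \<in> Sub C B \<Longrightarrow> preimg C f q \<in> Sub C A"
  by (metis preimgE sub_class_in_Sub)

text \<open>Let \<open>f \<cdot> m = i \<cdot> e\<close>. If \<open>i\<close> factors through \<open>n\<close>, then \<open>m\<close> is a leg of a cone over \<open>f\<close> and \<open>n\<close>, and so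
  factors through the pullback; conversely such a factorization of \<open>m\<close> yields a square between \<open>e\<close> and
  \<open>n\<close>, whose diagonal factors \<open>i\<close>.\<close>

lemma dimg_le_iff_le_preimg:
  assumes f: "f \<in> Hom C A B" and p: "p \<in> Sub C A" and q: "q \<in> Sub C B"
  shows "dimg C f p \<sqsubseteq>\<^bsub>SubL C B\<^esub> q \<longleftrightarrow> p \<sqsubseteq>\<^bsub>SubL C A\<^esub> preimg C f q"
proof -
  obtain m where m: "m \<in> MM C" "Cod C m = A" "p = sub_class C m" by (rule SubE[OF p])
  have mH: "m \<in> Hom C (Dom C m) A" using MM_Hom m by auto
  obtain e i where ei: "e \<in> EE C" "i \<in> MM C" "e \<in> Hom C (Dom C m) (Dom C i)"
    "i \<in> Hom C (Dom C i) B" "i \<cdot> e = f \<cdot> m"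
    by (rule factorize[OF cmp_in_Hom[OF mH f]])
  have im: "dimg C f p = sub_class C i" using dimg_sub_class[OF f m(1,2)] m(3) ei by (auto simp: Hom_iff)
  obtain n k h where n: "n \<in> MM C" "Cod C n = B" "q = sub_class C n" and pb: "is_pullback C f n k h"
    and k: "k \<in> MM C" "Cod C k = A" "preimg C f q = sub_class C k"
    by (rule preimgE[OF f q])
  note D = is_pullbackD[OF pb]
  have df: "Dom C f = A" "Cod C f = B" using f by (auto simp: Hom_iff)
  have "factors_through C i n \<longleftrightarrow> factors_through C m k"
  proof
    assume "factors_through C i n"
    then obtain d where d: "d \<in> Hom C (Dom C i) (Dom C n)" "n \<cdot> d = i"
      by (auto simp: factors_through_def)
    have "f \<cdot> m = n \<cdot> (d \<cdot> e)" using cmp_assoc[OF ei(3) d(1) D(2)] d(2) ei(5) by simp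
    with is_pullback_lift[OF pb _ cmp_in_Hom[OF ei(3) d(1)], of m] mH df
    show "factors_through C m k" unfolding factors_through_def by metis
  next
    assume "factors_through C m k"
    then obtain u where u: "u \<in> Hom C (Dom C m) (Dom C k)" "k \<cdot> u = m"
      by (auto simp: factors_through_def)
    have "i \<cdot> e = n \<cdot> (h \<cdot> u)"
      using cmp_assoc[OF u(1) D(3,1)] cmp_assoc[OF u(1) D(4,2)] D(5) u(2) ei(5) by simp
    then show "factors_through C i n"
      using factors_through_diagonal[OF ei(1) n(1), of i "h \<cdot> u"] ei n cmp_in_Hom[OF u(1) D(4)]
      by (auto simp: Hom_iff)
  qed
  then show ?thesis using im m n k ei by (auto simp: sub_class_le_iff Hom_iff)
qed

lemma dimg_preimg_le: "f \<in> Hom C A B \<Longrightarrow> q \<in> Sub C B \<Longrightarrow> dimg C f (preimg C f q) \<sqsubseteq>\<^bsub>SubL C B\<^esub> q"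
  by (simp add: dimg_le_iff_le_preimg preimg_in_Sub Sub_le_refl)

lemma le_preimg_dimg: "f \<in> Hom C A B \<Longrightarrow> p \<in> Sub C A \<Longrightarrow> p \<sqsubseteq>\<^bsub>SubL C A\<^esub> preimg C f (dimg C f p)"
  by (simp add: dimg_le_iff_le_preimg[symmetric] dimg_in_Sub Sub_le_refl)

lemma dimg_mono:
  "\<lbrakk>f \<in> Hom C A B; p \<in> Sub C A; q \<in> Sub C A; p \<sqsubseteq>\<^bsub>SubL C A\<^esub> q\<rbrakk>
    \<Longrightarrow> dimg C f p \<sqsubseteq>\<^bsub>SubL C B\<^esub> dimg C f q"
  by (meson Sub_le_trans dimg_in_Sub dimg_le_iff_le_preimg le_preimg_dimg preimg_in_Sub)

lemma preimg_mono:
  "\<lbrakk>f \<in> Hom C A B; p \<in> Sub C B; q \<in> Sub C B; p \<sqsubseteq>\<^bsub>SubL C B\<^esub> q\<rbrakk>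
    \<Longrightarrow> preimg C f p \<sqsubseteq>\<^bsub>SubL C A\<^esub> preimg C f q"
  by (meson Sub_le_trans dimg_in_Sub dimg_le_iff_le_preimg dimg_preimg_le preimg_in_Sub)

lemma dimg_bot:
  assumes f: "f \<in> Hom C A B"
  shows "dimg C f (bot_sub C A) = bot_sub C B"
proof -
  have "A \<in> Obj C" "B \<in> Obj C" using f dom_in_Obj cod_in_Obj by (auto simp: Hom_iff)
  then show ?thesis
    by (simp add: eq_bot_iff dimg_in_Sub[OF f] bot_in_Sub_least dimg_le_iff_le_preimg[OF f]
        preimg_in_Sub[OF f])
qed

lemma dimg_cmp:
  assumes f: "f \<in> Hom C A B" and g: "g \<in> Hom C B D" and p: "p \<in> Sub C A"
  shows "dimg C (g \<cdot> f) p = dimg C g (dimg C f p)"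
proof -
  obtain m where m: "m \<in> MM C" "Cod C m = A" "p = sub_class C m" by (rule SubE[OF p])
  have mH: "m \<in> Hom C (Dom C m) A" using MM_Hom m by auto
  obtain e n where en: "e \<in> EE C" "n \<in> MM C" "e \<in> Hom C (Dom C m) (Dom C n)"
    "n \<in> Hom C (Dom C n) B" "n \<cdot> e = f \<cdot> m"
    by (rule factorize[OF cmp_in_Hom[OF mH f]])
  obtain e' n' where en': "e' \<in> EE C" "n' \<in> MM C" "e' \<in> Hom C (Dom C n) (Dom C n')"
    "n' \<in> Hom C (Dom C n') D" "n' \<cdot> e' = g \<cdot> n"
    by (rule factorize[OF cmp_in_Hom[OF en(4) g]])
  have 1: "dimg C f p = sub_class C n" using dimg_sub_class[OF f m(1,2)] m(3) en by (auto simp: Hom_iff)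
  have 2: "dimg C g (sub_class C n) = sub_class C n'"
    using dimg_sub_class[OF g en(2)] en en' by (auto simp: Hom_iff)
  have "(g \<cdot> f) \<cdot> m = n' \<cdot> (e' \<cdot> e)"
    using cmp_assoc[OF mH f g] en(5) cmp_assoc[OF en(3,4) g] cmp_assoc[OF en(3) en'(3,4)] en'(5) by simp
  moreover have "e' \<cdot> e \<in> EE C" using EE_cmp[OF en(1) en'(1)] en(3) en'(3) by (auto simp: Hom_iff)
  moreover have "Cod C (e' \<cdot> e) = Dom C n'" using cmp_typing[OF en(3) en'(3)] by simp
  ultimately have "dimg C (g \<cdot> f) p = sub_class C n'"
    using dimg_sub_class[OF cmp_in_Hom[OF f g] m(1,2)] m(3) en'(2) by simp
  with 1 2 show ?thesis by simp
qed

text \<open>The pullback square itself exhibits \<open>n\<close> as the \<open>M\<close>-part of \<open>f \<cdot> k\<close>.\<close>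

lemma dimg_preimg_formally_surjective:
  assumes f: "f \<in> Hom C A B" and surj: "formally_surjective C f" and q: "q \<in> Sub C B"
  shows "dimg C f (preimg C f q) = q"
proof -
  obtain n k h where n: "n \<in> MM C" "Cod C n = B" "q = sub_class C n" and pb: "is_pullback C f n k h"
    and k: "k \<in> MM C" "Cod C k = A" "preimg C f q = sub_class C k"
    by (rule preimgE[OF f q])
  have "Cod C f = B" using f by (simp add: Hom_iff)
  then have "h \<in> EE C" using surj n pb unfolding formally_surjective_def by blast
  then show ?thesis
    using dimg_sub_class[OF f k(1,2) _ n(1)] is_pullbackD(4,5)[OF pb] n(3) k(3) by (auto simp: Hom_iff)
qed


section \<open>Images along \<open>M\<close>-morphisms\<close>

lemma dimg_MM_top: "m \<in> MM C \<Longrightarrow> dimg C m (sub_class C (Idt C (Dom C m))) = sub_class C m"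
  using dimg_MM_sub_class[of m "Idt C (Dom C m)"] Idt_MM MM_Obj idt_right[OF MM_Hom] by simp

lemma dimg_MM_le_iff:
  assumes m: "m \<in> MM C" and p: "p \<in> Sub C (Dom C m)" and q: "q \<in> Sub C (Dom C m)"
  shows "dimg C m p \<sqsubseteq>\<^bsub>SubL C (Cod C m)\<^esub> dimg C m q \<longleftrightarrow> p \<sqsubseteq>\<^bsub>SubL C (Dom C m)\<^esub> q"
proof
  assume le: "dimg C m p \<sqsubseteq>\<^bsub>SubL C (Cod C m)\<^esub> dimg C m q"
  note mH = MM_Hom[OF m]
  obtain a where a: "a \<in> MM C" "Cod C a = Dom C m" "p = sub_class C a" by (rule SubE[OF p])
  obtain b where b: "b \<in> MM C" "Cod C b = Dom C m" "q = sub_class C b" by (rule SubE[OF q])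
  have H: "a \<in> Hom C (Dom C a) (Dom C m)" "b \<in> Hom C (Dom C b) (Dom C m)"
    using MM_Hom a b by metis+
  have "m \<cdot> a \<in> MM C" "m \<cdot> b \<in> MM C" using MM_cmp m a b by auto
  then have "factors_through C (m \<cdot> a) (m \<cdot> b)"
    using le dimg_MM_sub_class[OF m] a b cmp_typing[OF _ mH] H by (simp add: sub_class_le_iff)
  then obtain u where u: "u \<in> Hom C (Dom C a) (Dom C b)" "(m \<cdot> b) \<cdot> u = m \<cdot> a"
    using cmp_typing[OF _ mH] H by (auto simp: factors_through_def)
  then have "m \<cdot> (b \<cdot> u) = m \<cdot> a" using cmp_assoc[OF u(1) H(2) mH] by simp
  then have "b \<cdot> u = a" using MM_cancel[OF m cmp_in_Hom[OF u(1) H(2)] H(1)] by blast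
  then show "p \<sqsubseteq>\<^bsub>SubL C (Dom C m)\<^esub> q"
    using u(1) a b by (auto simp: sub_class_le_iff factors_through_def)
qed (use dimg_mono[OF MM_Hom[OF m] p q] in simp)

lemma preimg_dimg_MM:
  assumes m: "m \<in> MM C" and p: "p \<in> Sub C (Dom C m)"
  shows "preimg C m (dimg C m p) = p"
proof -
  note mH = MM_Hom[OF m]
  have q: "preimg C m (dimg C m p) \<in> Sub C (Dom C m)" using dimg_in_Sub preimg_in_Sub mH p by blast
  have "preimg C m (dimg C m p) \<sqsubseteq>\<^bsub>SubL C (Dom C m)\<^esub> p"
    using dimg_preimg_le[OF mH dimg_in_Sub[OF mH p]] dimg_MM_le_iff[OF m q p] by simp
  then show ?thesis using le_preimg_dimg[OF mH p] Sub_le_antisym q p by blast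
qed

text \<open>If \<open>q = m \<cdot> c\<close>, then \<open>c\<close> and \<open>id\<close> form a cone over \<open>m\<close> and \<open>q\<close>, so \<open>c\<close> factors through
  \<open>m\<^sup>-\<^sup>1 q\<close>.\<close>

lemma dimg_preimg_MM:
  assumes m: "m \<in> MM C" and q: "q \<in> Sub C (Cod C m)" and le: "q \<sqsubseteq>\<^bsub>SubL C (Cod C m)\<^esub> sub_class C m"
  shows "dimg C m (preimg C m q) = q"
proof (rule Sub_le_antisym)
  note mH = MM_Hom[OF m]
  show "dimg C m (preimg C m q) \<in> Sub C (Cod C m)" using dimg_in_Sub preimg_in_Sub mH q by blast
  show "dimg C m (preimg C m q) \<sqsubseteq>\<^bsub>SubL C (Cod C m)\<^esub> q" by (rule dimg_preimg_le[OF mH q])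
  obtain n k h where n: "n \<in> MM C" "Cod C n = Cod C m" "q = sub_class C n" and pb: "is_pullback C m n k h"
    and k: "k \<in> MM C" "Cod C k = Dom C m" "preimg C m q = sub_class C k"
    by (rule preimgE[OF mH q])
  have kH: "k \<in> Hom C (Dom C k) (Dom C m)" and nH: "n \<in> Hom C (Dom C n) (Cod C n)"
    using MM_Hom k n by metis+
  obtain c where c: "c \<in> Hom C (Dom C n) (Dom C m)" "m \<cdot> c = n"
    using le m n by (auto simp: sub_class_le_iff factors_through_def)
  have "m \<cdot> c = n \<cdot> Idt C (Dom C n)" using c(2) idt_right[OF nH] by simp
  from is_pullback_lift[OF pb c(1) idt_in_Hom[OF MM_Obj(1)[OF n(1)]] this]
  obtain u where u: "u \<in> Hom C (Dom C n) (Dom C k)" "k \<cdot> u = c" by metis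
  then have "(m \<cdot> k) \<cdot> u = n" using cmp_assoc[OF u(1) kH mH] c(2) by simp
  then have "factors_through C n (m \<cdot> k)"
    using u(1) cmp_typing[OF kH mH] by (auto simp: factors_through_def)
  moreover have "m \<cdot> k \<in> MM C" using MM_cmp k m by simp
  ultimately show "q \<sqsubseteq>\<^bsub>SubL C (Cod C m)\<^esub> dimg C m (preimg C m q)"
    using dimg_MM_sub_class[OF m k(1,2)] k(3) n cmp_typing[OF kH mH] by (simp add: sub_class_le_iff)
qed (rule q)

lemma dimg_MM_le:
  assumes m: "m \<in> MM C" and p: "p \<in> Sub C (Dom C m)"
  shows "dimg C m p \<sqsubseteq>\<^bsub>SubL C (Cod C m)\<^esub> sub_class C m"
  using dimg_mono[OF MM_Hom[OF m] p top_in_Sub le_top] dimg_MM_top[OF m] MM_Obj[OF m] p by simp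

text \<open>Disjointness phrased with lower bounds can be moved along adjunctions.\<close>

lemma meet_bot_iff:
  assumes X: "X \<in> Obj C" and p: "p \<in> Sub C X" and q: "q \<in> Sub C X"
  shows "p \<sqinter>\<^bsub>SubL C X\<^esub> q = bot_sub C X \<longleftrightarrow>
    (\<forall>w \<in> Sub C X. w \<sqsubseteq>\<^bsub>SubL C X\<^esub> p \<longrightarrow> w \<sqsubseteq>\<^bsub>SubL C X\<^esub> q \<longrightarrow> w \<sqsubseteq>\<^bsub>SubL C X\<^esub> bot_sub C X)"
proof -
  interpret L: complete_lattice "SubL C X" by (rule Sub_complete[OF X])
  have c: "carrier (SubL C X) = Sub C X" by (simp add: SubL_def)
  have "p \<sqinter>\<^bsub>SubL C X\<^esub> q \<in> Sub C X" using L.meet_closed p q c by simp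
  then show ?thesis
    using L.meet_left[of p q] L.meet_right[of p q] L.meet_le[of _ p q] p q c eq_bot_iff[OF X] by metis
qed

text \<open>The instance of Frobenius reciprocity that closedness depends on. Direct image along \<open>m\<close> is an order
  isomorphism onto the subobjects below \<open>m\<close>, so it matches the common lower bounds of \<open>m\<^sup>-\<^sup>1 v\<close> and \<open>p\<close>
  with those of \<open>v\<close> and \<open>\<exists>\<^sub>m p\<close>.\<close>

lemma disjoint_dimg_MM_iff:
  assumes m: "m \<in> MM C" and v: "v \<in> Sub C (Cod C m)" and p: "p \<in> Sub C (Dom C m)"
  shows "v \<sqinter>\<^bsub>SubL C (Cod C m)\<^esub> dimg C m p = bot_sub C (Cod C m) \<longleftrightarrow>
    preimg C m v \<sqinter>\<^bsub>SubL C (Dom C m)\<^esub> p = bot_sub C (Dom C m)"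
proof -
  note mH = MM_Hom[OF m] and O = MM_Obj[OF m]
  note S = dimg_in_Sub[OF mH] preimg_in_Sub[OF mH] bot_in_Sub_least(1)[OF O(1)]
  have bot: "dimg C m w \<sqsubseteq>\<^bsub>SubL C (Cod C m)\<^esub> bot_sub C (Cod C m) \<longleftrightarrow>
    w \<sqsubseteq>\<^bsub>SubL C (Dom C m)\<^esub> bot_sub C (Dom C m)" if "w \<in> Sub C (Dom C m)" for w
    using dimg_MM_le_iff[OF m that S(3)] dimg_bot[OF mH] by simp
  have "(\<forall>w \<in> Sub C (Cod C m). w \<sqsubseteq>\<^bsub>SubL C (Cod C m)\<^esub> v \<longrightarrow> w \<sqsubseteq>\<^bsub>SubL C (Cod C m)\<^esub> dimg C m p
        \<longrightarrow> w \<sqsubseteq>\<^bsub>SubL C (Cod C m)\<^esub> bot_sub C (Cod C m)) \<longleftrightarrow>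
      (\<forall>w \<in> Sub C (Dom C m). w \<sqsubseteq>\<^bsub>SubL C (Dom C m)\<^esub> preimg C m v \<longrightarrow> w \<sqsubseteq>\<^bsub>SubL C (Dom C m)\<^esub> p
        \<longrightarrow> w \<sqsubseteq>\<^bsub>SubL C (Dom C m)\<^esub> bot_sub C (Dom C m))" (is "?L \<longleftrightarrow> ?R")
  proof
    assume ?L
    then show ?R using bot dimg_MM_le_iff[OF m _ p] dimg_le_iff_le_preimg[OF mH _ v] S(1) by blast
  next
    assume R: ?R
    show ?L
    proof (intro ballI impI)
      fix w assume w: "w \<in> Sub C (Cod C m)" "w \<sqsubseteq>\<^bsub>SubL C (Cod C m)\<^esub> v"
        "w \<sqsubseteq>\<^bsub>SubL C (Cod C m)\<^esub> dimg C m p"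
      have "w \<sqsubseteq>\<^bsub>SubL C (Cod C m)\<^esub> sub_class C m"
        using Sub_le_trans[OF w(3) dimg_MM_le[OF m p]] w(1) S(1)[OF p] sub_class_in_Sub[OF m] by simp
      then have eq: "dimg C m (preimg C m w) = w" using dimg_preimg_MM[OF m w(1)] by simp
      have "preimg C m w \<sqsubseteq>\<^bsub>SubL C (Dom C m)\<^esub> p"
        using dimg_MM_le_iff[OF m S(2)[OF w(1)] p] eq w(3) by simp
      then have "preimg C m w \<sqsubseteq>\<^bsub>SubL C (Dom C m)\<^esub> bot_sub C (Dom C m)"
        using R preimg_mono[OF mH w(1) v w(2)] S(2)[OF w(1)] by blast
      then show "w \<sqsubseteq>\<^bsub>SubL C (Cod C m)\<^esub> bot_sub C (Cod C m)"
        using bot[OF S(2)[OF w(1)]] eq by simp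
    qed
  qed
  then show ?thesis
    using meet_bot_iff[OF O(2) v S(1)[OF p]] meet_bot_iff[OF O(1) S(2)[OF v] p] by simp
qed

text \<open>Pasting of pullbacks, obtained from the adjunctions: both sides have the same lower bounds
  among the subobjects of \<open>k\<close>.\<close>

lemma preimg_dimg_pullback:
  assumes pb: "is_pullback C f m k h" and m: "m \<in> MM C" and t: "t \<in> Sub C (Dom C m)"
  shows "preimg C f (dimg C m t) = dimg C k (preimg C h t)"
proof -
  note D = is_pullbackD[OF pb] and k = MM_pullback_stable[OF pb m]
  have cod: "Cod C m = Cod C f" "Cod C k = Dom C f" using D by (auto simp: Hom_iff)
  have mt: "dimg C m t \<in> Sub C (Cod C f)" by (rule dimg_in_Sub[OF D(2) t])
  have q: "preimg C f (dimg C m t) \<in> Sub C (Dom C f)" by (rule preimg_in_Sub[OF D(1) mt])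
  have ht: "preimg C h t \<in> Sub C (Dom C k)" by (rule preimg_in_Sub[OF D(4) t])
  have swap: "dimg C k w \<sqsubseteq>\<^bsub>SubL C (Dom C f)\<^esub> preimg C f (dimg C m t) \<longleftrightarrow>
      w \<sqsubseteq>\<^bsub>SubL C (Dom C k)\<^esub> preimg C h t" if w: "w \<in> Sub C (Dom C k)" for w
  proof -
    have "dimg C f (dimg C k w) = dimg C m (dimg C h w)"
      using dimg_cmp[OF D(3,1) w] dimg_cmp[OF D(4,2) w] D(5) by simp
    then show ?thesis
      using dimg_le_iff_le_preimg[OF D(1) dimg_in_Sub[OF D(3) w] mt]
        dimg_le_iff_le_preimg[OF D(4) w t] dimg_MM_le_iff[OF m dimg_in_Sub[OF D(4) w] t] cod by simp
  qed
  have "preimg C f (dimg C m t) \<sqsubseteq>\<^bsub>SubL C (Dom C f)\<^esub> sub_class C k"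
    using preimg_mono[OF D(1) mt, of "sub_class C m"] dimg_MM_le[OF m t] preimg_sub_class[OF pb m]
      sub_class_in_Sub[OF m] cod by simp
  then obtain w where w: "w \<in> Sub C (Dom C k)" "dimg C k w = preimg C f (dimg C m t)"
    using dimg_preimg_MM[OF k, of "preimg C f (dimg C m t)"] q preimg_in_Sub[OF D(3) q] cod by auto
  have "w = preimg C h t"
  proof (rule Sub_le_antisym[OF _ _ w(1) ht])
    show "w \<sqsubseteq>\<^bsub>SubL C (Dom C k)\<^esub> preimg C h t" using swap[OF w(1)] Sub_le_refl[OF q] w(2) by simp
    show "preimg C h t \<sqsubseteq>\<^bsub>SubL C (Dom C k)\<^esub> w"
      using swap[OF ht] Sub_le_refl[OF ht] dimg_MM_le_iff[OF k ht w(1)] w(2) cod by simp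
  qed
  with w(2) show ?thesis by simp
qed


section \<open>Closed subobjects\<close>

text \<open>The part of the axioms of a preneighbourhood system on which the description of closed
  subobjects rests; restricted systems inherit it directly.\<close>

definition neighbourhood_assignment :: "'o \<Rightarrow> ('a set \<Rightarrow> 'a set set) \<Rightarrow> bool" where
  "neighbourhood_assignment X \<mu> \<longleftrightarrow>
     (\<forall>x \<in> Sub C X. \<mu> x \<noteq> {} \<and> \<mu> x \<subseteq> Sub C X \<and> (\<forall>u \<in> \<mu> x. x \<sqsubseteq>\<^bsub>SubL C X\<^esub> u))"

lemma neighbourhood_assignmentI:
  "preneighbourhood_space C X \<mu> \<Longrightarrow> neighbourhood_assignment X \<mu>"
  by (auto simp: neighbourhood_assignment_def preneighbourhood_space_def
      preneighbourhood_system_def Fil_def)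

lemma neighbourhood_assignment_restricted:
  assumes m: "m \<in> MM C" and \<mu>: "neighbourhood_assignment (Cod C m) \<mu>"
  shows "neighbourhood_assignment (Dom C m) (restricted C \<mu> m)"
  unfolding neighbourhood_assignment_def
proof (intro ballI conjI)
  note mH = MM_Hom[OF m] and O = MM_Obj[OF m]
  fix x assume x: "x \<in> Sub C (Dom C m)"
  have cx: "comp_sub C m x = dimg C m x" and mx: "dimg C m x \<in> Sub C (Cod C m)"
    using comp_sub_eq_dimg[OF m x] dimg_in_Sub[OF mH x] by auto
  obtain v where v: "v \<in> \<mu> (dimg C m x)" "v \<in> Sub C (Cod C m)"
    using \<mu> mx unfolding neighbourhood_assignment_def by blast
  have "preimg C m v \<in> restricted C \<mu> m x"
    using v cx preimg_in_Sub[OF mH v(2)] Sub_le_refl by (auto simp: restricted_def)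
  then show "restricted C \<mu> m x \<noteq> {}" by blast
  show "restricted C \<mu> m x \<subseteq> Sub C (Dom C m)" by (auto simp: restricted_def)
  fix u assume "u \<in> restricted C \<mu> m x"
  then obtain v where u: "u \<in> Sub C (Dom C m)" and v: "v \<in> \<mu> (dimg C m x)"
    "preimg C m v \<sqsubseteq>\<^bsub>SubL C (Dom C m)\<^esub> u"
    using cx by (auto simp: restricted_def)
  have vS: "v \<in> Sub C (Cod C m)" "dimg C m x \<sqsubseteq>\<^bsub>SubL C (Cod C m)\<^esub> v"
    using \<mu> mx v unfolding neighbourhood_assignment_def by blast+
  then have "x \<sqsubseteq>\<^bsub>SubL C (Dom C m)\<^esub> preimg C m v"
    using dimg_le_iff_le_preimg[OF mH x] by blast
  then show "x \<sqsubseteq>\<^bsub>SubL C (Dom C m)\<^esub> u"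
    using Sub_le_trans[OF _ v(2) x preimg_in_Sub[OF mH vS(1)] u] by blast
qed

text \<open>The supremum defining \<open>cl p\<close> always dominates \<open>p\<close>: the least subobject is below everything, and
  any other \<open>p\<close> meets each of its neighbourhoods in \<open>p\<close> itself, so \<open>p\<close> is one of the joined elements.
  Hence \<open>p\<close> is closed iff all joined elements lie below \<open>p\<close>.\<close>

lemma closed_subs_iff_comparable:
  assumes X: "X \<in> Obj C" and \<mu>: "neighbourhood_assignment X \<mu>"
  shows "p \<in> closed_subs C X \<mu> \<longleftrightarrow> p \<in> Sub C X \<and>
    (\<forall>x \<in> Sub C X. x \<notin> Far C X \<mu> p \<longrightarrow> x \<sqsubseteq>\<^bsub>SubL C X\<^esub> p \<or> p \<sqsubseteq>\<^bsub>SubL C X\<^esub> x)"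
proof (cases "p \<in> Sub C X")
  case p: True
  interpret L: complete_lattice "SubL C X" by (rule Sub_complete[OF X])
  have c: "carrier (SubL C X) = Sub C X" by (simp add: SubL_def)
  define S where "S = {x \<in> Sub C X. \<not> p \<sqsubset>\<^bsub>SubL C X\<^esub> x \<and> x \<notin> Far C X \<mu> p}"
  have cl: "cl C X \<mu> p = \<Squnion>\<^bsub>SubL C X\<^esub> S" by (simp add: cl_def S_def)
  have SS: "S \<subseteq> carrier (SubL C X)" by (auto simp: S_def c)
  have clS: "cl C X \<mu> p \<in> Sub C X" using L.sup_closed[OF SS] c cl by simp
  have ge: "p \<sqsubseteq>\<^bsub>SubL C X\<^esub> cl C X \<mu> p"
  proof (cases "p = bot_sub C X")
    case True then show ?thesis using bot_in_Sub_least[OF X] clS by simp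
  next
    case False
    have "p \<notin> Far C X \<mu> p"
    proof
      assume "p \<in> Far C X \<mu> p"
      then obtain u where u: "u \<in> \<mu> p" "u \<sqinter>\<^bsub>SubL C X\<^esub> p = bot_sub C X" by (auto simp: Far_def)
      have uS: "u \<in> Sub C X" and pu: "p \<sqsubseteq>\<^bsub>SubL C X\<^esub> u"
        using \<mu> p u(1) unfolding neighbourhood_assignment_def by blast+
      have "p \<sqsubseteq>\<^bsub>SubL C X\<^esub> bot_sub C X"
        using u(2) p pu Sub_le_refl[OF p] unfolding meet_bot_iff[OF X uS p] by blast
      with False show False using eq_bot_iff[OF X p] by blast
    qed
    then have "p \<in> S" using p by (simp add: S_def Sub_less_iff)
    then show ?thesis using L.sup_upper[OF SS] unfolding cl by blast
  qed
  have "p \<in> closed_subs C X \<mu> \<longleftrightarrow> cl C X \<mu> p \<sqsubseteq>\<^bsub>SubL C X\<^esub> p"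
    unfolding closed_subs_def using p ge clS Sub_le_antisym[OF _ ge clS p] Sub_le_refl[OF p] by auto
  also have "\<dots> \<longleftrightarrow> (\<forall>x \<in> S. x \<sqsubseteq>\<^bsub>SubL C X\<^esub> p)"
  proof
    assume le: "cl C X \<mu> p \<sqsubseteq>\<^bsub>SubL C X\<^esub> p"
    show "\<forall>x \<in> S. x \<sqsubseteq>\<^bsub>SubL C X\<^esub> p"
    proof
      fix x assume x: "x \<in> S"
      have "x \<sqsubseteq>\<^bsub>SubL C X\<^esub> cl C X \<mu> p" unfolding cl by (rule L.sup_upper[OF SS x])
      from Sub_le_trans[OF this le _ clS p] x show "x \<sqsubseteq>\<^bsub>SubL C X\<^esub> p" by (simp add: S_def)
    qed
  next
    assume "\<forall>x \<in> S. x \<sqsubseteq>\<^bsub>SubL C X\<^esub> p"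
    then show "cl C X \<mu> p \<sqsubseteq>\<^bsub>SubL C X\<^esub> p"
      unfolding cl by (intro L.sup_least[OF SS]) (use p c in auto)
  qed
  also have "\<dots> \<longleftrightarrow> (\<forall>x \<in> Sub C X. x \<notin> Far C X \<mu> p \<longrightarrow> x \<sqsubseteq>\<^bsub>SubL C X\<^esub> p \<or> p \<sqsubseteq>\<^bsub>SubL C X\<^esub> x)"
    unfolding S_def Sub_less_iff using Sub_le_refl[OF p] by blast
  finally show ?thesis using p by simp
qed (simp add: closed_subs_def)

lemma closed_subs_Sub: "p \<in> closed_subs C X \<mu> \<Longrightarrow> p \<in> Sub C X"
  by (simp add: closed_subs_def)

lemma Far_antimono:
  assumes X: "X \<in> Obj C" and \<mu>: "neighbourhood_assignment X \<mu>"
    and p: "p \<in> Sub C X" and q: "q \<in> Sub C X" and le: "p \<sqsubseteq>\<^bsub>SubL C X\<^esub> q"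
  shows "Far C X \<mu> q \<subseteq> Far C X \<mu> p"
proof
  fix x assume "x \<in> Far C X \<mu> q"
  then obtain u where x: "x \<in> Sub C X" and u: "u \<in> \<mu> x" "u \<sqinter>\<^bsub>SubL C X\<^esub> q = bot_sub C X"
    by (auto simp: Far_def)
  have uS: "u \<in> Sub C X" using \<mu> x u unfolding neighbourhood_assignment_def by blast
  have "u \<sqinter>\<^bsub>SubL C X\<^esub> p = bot_sub C X"
    using meet_bot_iff[OF X uS p] meet_bot_iff[OF X uS q] u(2) Sub_le_trans[OF _ le] p q by blast
  with x u show "x \<in> Far C X \<mu> p" by (auto simp: Far_def)
qed

text \<open>An \<open>x\<close> not far from the meet is not far from any member, hence comparable with each: it is below
  all of them, so below the meet, or above one of them, so above the meet.\<close>

lemma Inf_closed_subs: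
  assumes X: "X \<in> Obj C" and \<mu>: "neighbourhood_assignment X \<mu>" and T: "T \<subseteq> closed_subs C X \<mu>"
  shows "\<Sqinter>\<^bsub>SubL C X\<^esub> T \<in> closed_subs C X \<mu>"
proof -
  interpret L: complete_lattice "SubL C X" by (rule Sub_complete[OF X])
  have c: "carrier (SubL C X) = Sub C X" by (simp add: SubL_def)
  have TS: "T \<subseteq> carrier (SubL C X)" using T c closed_subs_Sub by auto
  let ?p = "\<Sqinter>\<^bsub>SubL C X\<^esub> T"
  have p: "?p \<in> Sub C X" using L.inf_closed[OF TS] c by simp
  have low: "?p \<sqsubseteq>\<^bsub>SubL C X\<^esub> t" if "t \<in> T" for t using L.inf_lower[OF TS that] .
  have "x \<sqsubseteq>\<^bsub>SubL C X\<^esub> ?p \<or> ?p \<sqsubseteq>\<^bsub>SubL C X\<^esub> x" if x: "x \<in> Sub C X" "x \<notin> Far C X \<mu> ?p" for x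
  proof (cases "\<forall>t \<in> T. x \<sqsubseteq>\<^bsub>SubL C X\<^esub> t")
    case True
    then have "x \<sqsubseteq>\<^bsub>SubL C X\<^esub> ?p" using L.inf_greatest[OF TS, of x] x(1) c by blast
    then show ?thesis ..
  next
    case False
    then obtain t where t: "t \<in> T" "\<not> x \<sqsubseteq>\<^bsub>SubL C X\<^esub> t" by blast
    have tS: "t \<in> Sub C X" using t TS c by auto
    have "x \<notin> Far C X \<mu> t" using Far_antimono[OF X \<mu> p tS low] t x by blast
    then have "t \<sqsubseteq>\<^bsub>SubL C X\<^esub> x" using closed_subs_iff_comparable[OF X \<mu>] T t x by blast
    then show ?thesis using Sub_le_trans[OF low[OF t(1)]] p tS x(1) by blast
  qed
  then show ?thesis using closed_subs_iff_comparable[OF X \<mu>] p by blast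
qed

lemma cl_hat_hull:
  assumes X: "X \<in> Obj C" and \<mu>: "neighbourhood_assignment X \<mu>" and p: "p \<in> Sub C X"
  shows cl_hat_closed: "cl_hat C X \<mu> p \<in> closed_subs C X \<mu>"
    and le_cl_hat: "p \<sqsubseteq>\<^bsub>SubL C X\<^esub> cl_hat C X \<mu> p"
    and cl_hat_least: "\<lbrakk>t \<in> closed_subs C X \<mu>; p \<sqsubseteq>\<^bsub>SubL C X\<^esub> t\<rbrakk> \<Longrightarrow> cl_hat C X \<mu> p \<sqsubseteq>\<^bsub>SubL C X\<^esub> t"
proof -
  interpret L: complete_lattice "SubL C X" by (rule Sub_complete[OF X])
  have c: "carrier (SubL C X) = Sub C X" by (simp add: SubL_def)
  have TS: "{t \<in> closed_subs C X \<mu>. p \<sqsubseteq>\<^bsub>SubL C X\<^esub> t} \<subseteq> carrier (SubL C X)"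
    using c closed_subs_Sub by auto
  show "cl_hat C X \<mu> p \<in> closed_subs C X \<mu>"
    unfolding cl_hat_def by (rule Inf_closed_subs[OF X \<mu>]) blast
  show "p \<sqsubseteq>\<^bsub>SubL C X\<^esub> cl_hat C X \<mu> p"
    unfolding cl_hat_def by (rule L.inf_greatest[OF TS]) (use p c in auto)
  show "cl_hat C X \<mu> p \<sqsubseteq>\<^bsub>SubL C X\<^esub> t" if "t \<in> closed_subs C X \<mu>" "p \<sqsubseteq>\<^bsub>SubL C X\<^esub> t"
    unfolding cl_hat_def by (rule L.inf_lower[OF TS]) (use that in auto)
qed

lemma cl_hat_eq:
  assumes X: "X \<in> Obj C" and \<mu>: "neighbourhood_assignment X \<mu>" and p: "p \<in> closed_subs C X \<mu>"
  shows "cl_hat C X \<mu> p = p"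
  by (meson Sub_le_antisym Sub_le_refl X \<mu> cl_hat_closed cl_hat_least closed_subs_Sub le_cl_hat p)


section \<open>Closed morphisms\<close>

text \<open>A subobject \<open>t\<close> is closed iff \<open>cl_hat t \<le> t\<close>, which makes both directions formal.\<close>

lemma closed_morphism_iff_cl_hat:
  assumes X: "X \<in> Obj C" and \<mu>: "neighbourhood_assignment X \<mu>"
    and Y: "Y \<in> Obj C" and \<phi>: "neighbourhood_assignment Y \<phi>" and f: "f \<in> Hom C X Y"
  shows "closed_morphism C X \<mu> Y \<phi> f \<longleftrightarrow>
    (\<forall>p \<in> Sub C X. cl_hat C Y \<phi> (dimg C f p) \<sqsubseteq>\<^bsub>SubL C Y\<^esub> dimg C f (cl_hat C X \<mu> p))" (is "_ \<longleftrightarrow> ?R")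
proof
  assume cf: "closed_morphism C X \<mu> Y \<phi> f"
  show ?R
  proof
    fix p assume p: "p \<in> Sub C X"
    have cp: "cl_hat C X \<mu> p \<in> closed_subs C X \<mu>" by (rule cl_hat_closed[OF X \<mu> p])
    show "cl_hat C Y \<phi> (dimg C f p) \<sqsubseteq>\<^bsub>SubL C Y\<^esub> dimg C f (cl_hat C X \<mu> p)"
      by (rule cl_hat_least[OF Y \<phi> dimg_in_Sub[OF f p]])
        (use cf cp dimg_mono[OF f p closed_subs_Sub[OF cp] le_cl_hat[OF X \<mu> p]] in
          \<open>auto simp: closed_morphism_def\<close>)
  qed
next
  assume R: ?R
  have "dimg C f p \<in> closed_subs C Y \<phi>" if p: "p \<in> closed_subs C X \<mu>" for p
  proof -
    have pS: "p \<in> Sub C X" by (rule closed_subs_Sub[OF p])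
    note q = dimg_in_Sub[OF f pS]
    note cq = cl_hat_closed[OF Y \<phi> q]
    have "cl_hat C Y \<phi> (dimg C f p) \<sqsubseteq>\<^bsub>SubL C Y\<^esub> dimg C f p"
      using R pS cl_hat_eq[OF X \<mu> p] by auto
    then have "cl_hat C Y \<phi> (dimg C f p) = dimg C f p"
      using Sub_le_antisym[OF _ le_cl_hat[OF Y \<phi> q] closed_subs_Sub[OF cq] q] by blast
    with cq show ?thesis by simp
  qed
  then show "closed_morphism C X \<mu> Y \<phi> f" using f by (simp add: closed_morphism_def)
qed

text \<open>Continuity supplies the reverse inequality: \<open>f\<^sup>-\<^sup>1 (cl_hat (\<exists>\<^sub>f p))\<close> is closed and contains \<open>p\<close>.\<close>

lemma continuous_closed_iff_cl_hat:
  assumes X: "X \<in> Obj C" and \<mu>: "neighbourhood_assignment X \<mu>"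
    and Y: "Y \<in> Obj C" and \<phi>: "neighbourhood_assignment Y \<phi>" and f: "f \<in> Hom C X Y"
    and cont: "continuous_morphism C X \<mu> Y \<phi> f"
  shows "closed_morphism C X \<mu> Y \<phi> f \<longleftrightarrow>
    (\<forall>p \<in> Sub C X. dimg C f (cl_hat C X \<mu> p) = cl_hat C Y \<phi> (dimg C f p))"
proof -
  have S: "dimg C f (cl_hat C X \<mu> p) \<in> Sub C Y" "cl_hat C Y \<phi> (dimg C f p) \<in> Sub C Y"
    if p: "p \<in> Sub C X" for p
    using dimg_in_Sub[OF f] closed_subs_Sub cl_hat_closed[OF X \<mu> p]
      cl_hat_closed[OF Y \<phi> dimg_in_Sub[OF f p]] by blast+
  have "dimg C f (cl_hat C X \<mu> p) \<sqsubseteq>\<^bsub>SubL C Y\<^esub> cl_hat C Y \<phi> (dimg C f p)" if p: "p \<in> Sub C X" for p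
  proof -
    note q = dimg_in_Sub[OF f p]
    note cq = cl_hat_closed[OF Y \<phi> q]
    have "p \<sqsubseteq>\<^bsub>SubL C X\<^esub> preimg C f (cl_hat C Y \<phi> (dimg C f p))"
      using dimg_le_iff_le_preimg[OF f p closed_subs_Sub[OF cq]] le_cl_hat[OF Y \<phi> q] by simp
    then have "cl_hat C X \<mu> p \<sqsubseteq>\<^bsub>SubL C X\<^esub> preimg C f (cl_hat C Y \<phi> (dimg C f p))"
      using cl_hat_least[OF X \<mu> p] cont cq by (simp add: continuous_morphism_def)
    then show ?thesis
      using dimg_le_iff_le_preimg[OF f closed_subs_Sub[OF cl_hat_closed[OF X \<mu> p]] closed_subs_Sub[OF cq]]
      by simp
  qed
  then show ?thesis
    using closed_morphism_iff_cl_hat[OF X \<mu> Y \<phi> f] Sub_le_antisym Sub_le_refl S by metis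
qed

text \<open>A neighbourhood \<open>v\<close> of \<open>m \<cdot> x\<close> restricts to a cofinal neighbourhood \<open>m\<^sup>-\<^sup>1 v\<close> of \<open>x\<close>, and
  Frobenius reciprocity transports the disjointness.\<close>

lemma Far_restricted_iff:
  assumes m: "m \<in> MM C" and \<mu>: "neighbourhood_assignment (Cod C m) \<mu>"
    and x: "x \<in> Sub C (Dom C m)" and p: "p \<in> Sub C (Dom C m)"
  shows "x \<in> Far C (Dom C m) (restricted C \<mu> m) p \<longleftrightarrow> dimg C m x \<in> Far C (Cod C m) \<mu> (dimg C m p)"
proof
  note mH = MM_Hom[OF m] and O = MM_Obj[OF m]
  note mx = dimg_in_Sub[OF mH x] and cx = comp_sub_eq_dimg[OF m x]
  {
    assume "x \<in> Far C (Dom C m) (restricted C \<mu> m) p"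
    then obtain u v where u: "u \<in> Sub C (Dom C m)" "u \<sqinter>\<^bsub>SubL C (Dom C m)\<^esub> p = bot_sub C (Dom C m)"
      and v: "v \<in> \<mu> (dimg C m x)" "preimg C m v \<sqsubseteq>\<^bsub>SubL C (Dom C m)\<^esub> u"
      using cx by (auto simp: Far_def restricted_def)
    have vS: "v \<in> Sub C (Cod C m)" using \<mu> mx v unfolding neighbourhood_assignment_def by blast
    note pv = preimg_in_Sub[OF mH vS]
    have "preimg C m v \<sqinter>\<^bsub>SubL C (Dom C m)\<^esub> p = bot_sub C (Dom C m)"
      using meet_bot_iff[OF O(1) u(1) p] meet_bot_iff[OF O(1) pv p] u(2) Sub_le_trans[OF _ v(2) _ pv u(1)]
      by blast
    then show "dimg C m x \<in> Far C (Cod C m) \<mu> (dimg C m p)"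
      using disjoint_dimg_MM_iff[OF m vS p] mx v(1) by (auto simp: Far_def)
  next
    assume "dimg C m x \<in> Far C (Cod C m) \<mu> (dimg C m p)"
    then obtain v where v: "v \<in> \<mu> (dimg C m x)"
      "v \<sqinter>\<^bsub>SubL C (Cod C m)\<^esub> dimg C m p = bot_sub C (Cod C m)" by (auto simp: Far_def)
    have vS: "v \<in> Sub C (Cod C m)" using \<mu> mx v unfolding neighbourhood_assignment_def by blast
    note pv = preimg_in_Sub[OF mH vS]
    have "preimg C m v \<in> restricted C \<mu> m x"
      using pv v(1) cx Sub_le_refl by (auto simp: restricted_def)
    then show "x \<in> Far C (Dom C m) (restricted C \<mu> m) p"
      using disjoint_dimg_MM_iff[OF m vS p] v(2) x by (auto simp: Far_def)
  }
qed

text \<open>Comparability within the subspace is comparability of the images, since \<open>\<exists>\<^sub>m\<close> is an order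
  embedding.\<close>

lemma closed_in_subspace_if:
  assumes m: "m \<in> MM C" and \<mu>: "neighbourhood_assignment (Cod C m) \<mu>"
    and q: "q \<in> Sub C (Dom C m)" and cl: "dimg C m q \<in> closed_subs C (Cod C m) \<mu>"
  shows "q \<in> closed_subs C (Dom C m) (restricted C \<mu> m)"
proof -
  have "x \<sqsubseteq>\<^bsub>SubL C (Dom C m)\<^esub> q \<or> q \<sqsubseteq>\<^bsub>SubL C (Dom C m)\<^esub> x"
    if x: "x \<in> Sub C (Dom C m)" "x \<notin> Far C (Dom C m) (restricted C \<mu> m) q" for x
    using cl[unfolded closed_subs_iff_comparable[OF MM_Obj(2)[OF m] \<mu>]]
      dimg_in_Sub[OF MM_Hom[OF m] x(1)] Far_restricted_iff[OF m \<mu> x(1) q] x(2)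
      dimg_MM_le_iff[OF m x(1) q] dimg_MM_le_iff[OF m q x(1)] by blast
  then show ?thesis
    using closed_subs_iff_comparable[OF MM_Obj(1)[OF m] neighbourhood_assignment_restricted[OF m \<mu>]] q
    by blast
qed

text \<open>An \<open>x\<close> not far from \<open>m \<cdot> p\<close> is not far from \<open>m\<close>, hence above \<open>m\<close>, where there is nothing to
  show, or below \<open>m\<close>, where \<open>x\<close> comes from the subspace.\<close>

lemma dimg_closed_if_closed_in_subspace:
  assumes m: "m \<in> MM C" and \<mu>: "neighbourhood_assignment (Cod C m) \<mu>"
    and cl: "sub_class C m \<in> closed_subs C (Cod C m) \<mu>"
    and p: "p \<in> closed_subs C (Dom C m) (restricted C \<mu> m)"
  shows "dimg C m p \<in> closed_subs C (Cod C m) \<mu>"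
proof -
  note mH = MM_Hom[OF m] and O = MM_Obj[OF m]
  have pS: "p \<in> Sub C (Dom C m)" by (rule closed_subs_Sub[OF p])
  note mp = dimg_in_Sub[OF mH pS]
  have mS: "sub_class C m \<in> Sub C (Cod C m)" by (rule sub_class_in_Sub[OF m refl])
  have "x \<sqsubseteq>\<^bsub>SubL C (Cod C m)\<^esub> dimg C m p \<or> dimg C m p \<sqsubseteq>\<^bsub>SubL C (Cod C m)\<^esub> x"
    if x: "x \<in> Sub C (Cod C m)" "x \<notin> Far C (Cod C m) \<mu> (dimg C m p)" for x
  proof -
    have "x \<notin> Far C (Cod C m) \<mu> (sub_class C m)"
      using Far_antimono[OF O(2) \<mu> mp mS dimg_MM_le[OF m pS]] x by blast
    then consider "x \<sqsubseteq>\<^bsub>SubL C (Cod C m)\<^esub> sub_class C m" | "sub_class C m \<sqsubseteq>\<^bsub>SubL C (Cod C m)\<^esub> x"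
      using closed_subs_iff_comparable[OF O(2) \<mu>] cl x(1) by blast
    then show ?thesis
    proof cases
      case 1
      define x' where "x' = preimg C m x"
      have x': "x' \<in> Sub C (Dom C m)" "dimg C m x' = x"
        using preimg_in_Sub[OF mH x(1)] dimg_preimg_MM[OF m x(1) 1] by (auto simp: x'_def)
      then have "x' \<sqsubseteq>\<^bsub>SubL C (Dom C m)\<^esub> p \<or> p \<sqsubseteq>\<^bsub>SubL C (Dom C m)\<^esub> x'"
        using p[unfolded closed_subs_iff_comparable[OF O(1) neighbourhood_assignment_restricted[OF m \<mu>]]]
          Far_restricted_iff[OF m \<mu> x'(1) pS] x(2) by blast
      then show ?thesis using dimg_mono[OF mH x'(1) pS] dimg_mono[OF mH pS x'(1)] x'(2) by auto
    next
      case 2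
      then show ?thesis using Sub_le_trans[OF dimg_MM_le[OF m pS] 2 mp mS x(1)] by blast
    qed
  qed
  then show ?thesis using closed_subs_iff_comparable[OF O(2) \<mu>] mp by blast
qed

lemma closed_embedding_iff:
  assumes m: "m \<in> MM C" and \<mu>: "neighbourhood_assignment (Cod C m) \<mu>"
  shows "closed_morphism C (Dom C m) (restricted C \<mu> m) (Cod C m) \<mu> m \<longleftrightarrow>
    sub_class C m \<in> closed_subs C (Cod C m) \<mu>"
proof
  assume cm: "closed_morphism C (Dom C m) (restricted C \<mu> m) (Cod C m) \<mu> m"
  note O = MM_Obj(1)[OF m]
  have "sub_class C (Idt C (Dom C m)) \<in> closed_subs C (Dom C m) (restricted C \<mu> m)"
    using closed_subs_iff_comparable[OF O neighbourhood_assignment_restricted[OF m \<mu>]]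
      top_in_Sub[OF O] le_top[OF O] by blast
  then show "sub_class C m \<in> closed_subs C (Cod C m) \<mu>"
    using cm dimg_MM_top[OF m] unfolding closed_morphism_def by metis
next
  assume "sub_class C m \<in> closed_subs C (Cod C m) \<mu>"
  then show "closed_morphism C (Dom C m) (restricted C \<mu> m) (Cod C m) \<mu> m"
    using dimg_closed_if_closed_in_subspace[OF m \<mu>] MM_Hom[OF m] by (simp add: closed_morphism_def)
qed

text \<open>A pullback of \<open>n\<close> along the inverse is \<open>f \<cdot> n\<close>, with an identity as corestriction.\<close>

lemma preimg_inverse:
  assumes inv: "inverse_arrows C f h" and p: "p \<in> Sub C (Dom C f)"
  shows "preimg C h p = dimg C f p"
proof -
  note I = inverse_arrowsD[OF inv]
  have f: "f \<in> MM C" using inv iso_MM by (auto simp: is_iso_def)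
  obtain n where n: "n \<in> MM C" "Cod C n = Dom C f" "p = sub_class C n" by (rule SubE[OF p])
  have nH: "n \<in> Hom C (Dom C n) (Dom C f)" using MM_Hom n by metis
  have fn: "f \<cdot> n \<in> Hom C (Dom C n) (Cod C f)" by (rule cmp_in_Hom[OF nH I(1)])
  have N: "Idt C (Dom C n) \<in> Hom C (Dom C n) (Dom C n)" using idt_in_Hom MM_Obj n(1) by blast
  have h: "Dom C h = Cod C f" "Cod C h = Dom C f" "h \<in> Arr C" using I(2) by (auto simp: Hom_iff)
  have sq: "h \<cdot> (f \<cdot> n) = n \<cdot> Idt C (Dom C n)"
    using cmp_assoc[OF nH I(1,2)] I(3) idt_left[OF nH] idt_right[OF nH] by simp
  have "\<exists>!u. u \<in> Hom C Q (Dom C n) \<and> (f \<cdot> n) \<cdot> u = a \<and> Idt C (Dom C n) \<cdot> u = b"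
    if a: "a \<in> Hom C Q (Cod C f)" and b: "b \<in> Hom C Q (Dom C n)" and eq: "h \<cdot> a = n \<cdot> b" for Q a b
  proof (rule ex1I[of _ b])
    have "(f \<cdot> n) \<cdot> b = f \<cdot> (h \<cdot> a)" using cmp_assoc[OF b nH I(1)] eq by simp
    also have "\<dots> = a" using cmp_assoc[OF a I(2,1)] I(4) idt_left[OF a] by simp
    finally show "b \<in> Hom C Q (Dom C n) \<and> (f \<cdot> n) \<cdot> b = a \<and> Idt C (Dom C n) \<cdot> b = b"
      using b idt_left[OF b] by simp
  qed (use idt_left in auto)
  then have "is_pullback C h n (f \<cdot> n) (Idt C (Dom C n))"
    by (rule is_pullbackI[OF I(2) nH fn N sq])
  from preimg_sub_class[OF this n(1)] dimg_MM_sub_class[OF f n(1,2)] n(3) show ?thesis by simp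
qed

text \<open>Since the inverse respects the systems, \<open>\<exists>\<^sub>f\<close> carries neighbourhoods to neighbourhoods; as every
  subobject of the codomain is an image, not being far is reflected.\<close>

lemma closed_morphism_iso:
  assumes X: "X \<in> Obj C" and \<mu>: "neighbourhood_assignment X \<mu>"
    and Y: "Y \<in> Obj C" and \<phi>: "neighbourhood_assignment Y \<phi>" and f: "f \<in> Hom C X Y"
    and inv: "inverse_arrows C f h" and h: "preneighbourhood_morphism C Y \<phi> X \<mu> h"
  shows "closed_morphism C X \<mu> Y \<phi> f"
proof -
  have D: "Dom C f = X" "Cod C f = Y" using f by (auto simp: Hom_iff)
  note I = inverse_arrowsD[OF inv, unfolded D]
  have fM: "f \<in> MM C" using inv iso_MM by (auto simp: is_iso_def)
  have "dimg C f p \<in> closed_subs C Y \<phi>" if p: "p \<in> closed_subs C X \<mu>" for p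
  proof -
    have pS: "p \<in> Sub C X" by (rule closed_subs_Sub[OF p])
    have "y \<sqsubseteq>\<^bsub>SubL C Y\<^esub> dimg C f p \<or> dimg C f p \<sqsubseteq>\<^bsub>SubL C Y\<^esub> y"
      if y: "y \<in> Sub C Y" "y \<notin> Far C Y \<phi> (dimg C f p)" for y
    proof -
      obtain n where n: "n \<in> MM C" "Cod C n = Y" "y = sub_class C n" by (rule SubE[OF y(1)])
      have nH: "n \<in> Hom C (Dom C n) Y" using MM_Hom n by metis
      have "f \<cdot> (h \<cdot> n) = n" using cmp_assoc[OF nH I(2) f] I(4) idt_left[OF nH] by simp
      then have "y \<sqsubseteq>\<^bsub>SubL C Y\<^esub> sub_class C f"
        using cmp_in_Hom[OF nH I(2)] n fM D by (auto simp: sub_class_le_iff factors_through_def)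
      then have "dimg C f (preimg C f y) = y" using dimg_preimg_MM[OF fM] y(1) D by simp
      then obtain x where x: "x \<in> Sub C X" "dimg C f x = y" using preimg_in_Sub[OF f y(1)] by blast
      have "x \<notin> Far C X \<mu> p"
      proof
        assume "x \<in> Far C X \<mu> p"
        then obtain u where u: "u \<in> \<mu> x" "u \<sqinter>\<^bsub>SubL C X\<^esub> p = bot_sub C X" by (auto simp: Far_def)
        have uS: "u \<in> Sub C X" using \<mu> x u unfolding neighbourhood_assignment_def by blast
        have "dimg C f u \<in> \<phi> y"
          using h x u preimg_inverse[OF inv] uS D unfolding preneighbourhood_morphism_def by metis
        moreover have "dimg C f u \<sqinter>\<^bsub>SubL C Y\<^esub> dimg C f p = bot_sub C Y"
          using disjoint_dimg_MM_iff[OF fM, of "dimg C f u" p] dimg_in_Sub[OF f uS] pS uS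
            preimg_dimg_MM[OF fM] u(2) D by simp
        ultimately show False using y by (auto simp: Far_def)
      qed
      then have "x \<sqsubseteq>\<^bsub>SubL C X\<^esub> p \<or> p \<sqsubseteq>\<^bsub>SubL C X\<^esub> x"
        using closed_subs_iff_comparable[OF X \<mu>] p x(1) by blast
      then show ?thesis using dimg_mono[OF f x(1) pS] dimg_mono[OF f pS x(1)] x(2) by auto
    qed
    then show ?thesis using closed_subs_iff_comparable[OF Y \<phi>] dimg_in_Sub[OF f pS] by blast
  qed
  then show ?thesis using f by (simp add: closed_morphism_def)
qed

lemma closed_morphism_cmp:
  assumes f: "closed_morphism C X \<mu> Y \<phi> f" and g: "closed_morphism C Y \<phi> Z \<psi> g"
  shows "closed_morphism C X \<mu> Z \<psi> (g \<cdot> f)"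
proof -
  have H: "f \<in> Hom C X Y" "g \<in> Hom C Y Z" using assms by (auto simp: closed_morphism_def)
  show ?thesis
    using assms dimg_cmp[OF H] closed_subs_Sub cmp_in_Hom[OF H] by (simp add: closed_morphism_def)
qed

lemma closed_morphism_cancel_right:
  assumes gf: "closed_morphism C X \<mu> Z \<psi> (g \<cdot> f)" and surj: "formally_surjective C f"
    and f: "continuous_morphism C X \<mu> Y \<phi> f" and g: "g \<in> Hom C Y Z"
  shows "closed_morphism C Y \<phi> Z \<psi> g"
proof -
  have fH: "f \<in> Hom C X Y" using f by (simp add: continuous_morphism_def)
  have "dimg C g q \<in> closed_subs C Z \<psi>" if q: "q \<in> closed_subs C Y \<phi>" for q
  proof -
    have qS: "q \<in> Sub C Y" by (rule closed_subs_Sub[OF q])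
    have "dimg C g q = dimg C (g \<cdot> f) (preimg C f q)"
      using dimg_cmp[OF fH g preimg_in_Sub[OF fH qS]] dimg_preimg_formally_surjective[OF fH surj qS]
      by simp
    then show ?thesis using gf f q by (simp add: closed_morphism_def continuous_morphism_def)
  qed
  then show ?thesis using g by (simp add: closed_morphism_def)
qed

text \<open>Along the closed embeddings \<open>k = f\<^sup>-\<^sup>1 m\<close> and \<open>m\<close>, being closed in the subspace is the same as
  having a closed image, so both properties descend from \<open>f\<close>.\<close>

lemma corestriction_closed_continuous:
  assumes \<mu>: "neighbourhood_assignment X \<mu>" and \<phi>: "neighbourhood_assignment Y \<phi>"
    and cl: "closed_morphism C X \<mu> Y \<phi> f" and cont: "continuous_morphism C X \<mu> Y \<phi> f"
    and m: "m \<in> MM C" and mcl: "sub_class C m \<in> closed_subs C Y \<phi>"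
    and pb: "is_pullback C f m k h"
  shows "closed_morphism C (Dom C k) (restricted C \<mu> k) (Dom C m) (restricted C \<phi> m) h"
    and "continuous_morphism C (Dom C k) (restricted C \<mu> k) (Dom C m) (restricted C \<phi> m) h"
proof -
  have f: "Dom C f = X" "Cod C f = Y" using cl by (auto simp: closed_morphism_def Hom_iff)
  note D = is_pullbackD[OF pb, unfolded f] and k = MM_pullback_stable[OF pb m]
  have cod: "Cod C m = Y" "Cod C k = X" using D by (auto simp: Hom_iff)
  have kcl: "sub_class C k \<in> closed_subs C X \<mu>"
    using cont mcl preimg_sub_class[OF pb m] by (auto simp: continuous_morphism_def)
  have "dimg C h p \<in> closed_subs C (Dom C m) (restricted C \<phi> m)"
    if p: "p \<in> closed_subs C (Dom C k) (restricted C \<mu> k)" for p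
  proof -
    have pS: "p \<in> Sub C (Dom C k)" by (rule closed_subs_Sub[OF p])
    have "dimg C k p \<in> closed_subs C X \<mu>"
      using dimg_closed_if_closed_in_subspace[OF k] \<mu> kcl p cod by simp
    then have "dimg C f (dimg C k p) \<in> closed_subs C Y \<phi>" using cl by (simp add: closed_morphism_def)
    also have "dimg C f (dimg C k p) = dimg C m (dimg C h p)"
      using dimg_cmp[OF D(3,1) pS] dimg_cmp[OF D(4,2) pS] D(5) by simp
    finally show ?thesis using closed_in_subspace_if[OF m] \<phi> dimg_in_Sub[OF D(4) pS] cod by simp
  qed
  then show "closed_morphism C (Dom C k) (restricted C \<mu> k) (Dom C m) (restricted C \<phi> m) h"
    using D(4) by (simp add: closed_morphism_def)
  have "preimg C h t \<in> closed_subs C (Dom C k) (restricted C \<mu> k)"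
    if t: "t \<in> closed_subs C (Dom C m) (restricted C \<phi> m)" for t
  proof -
    have tS: "t \<in> Sub C (Dom C m)" by (rule closed_subs_Sub[OF t])
    have "dimg C m t \<in> closed_subs C Y \<phi>"
      using dimg_closed_if_closed_in_subspace[OF m] \<phi> mcl t cod by simp
    then have "preimg C f (dimg C m t) \<in> closed_subs C X \<mu>" using cont by (simp add: continuous_morphism_def)
    then have "dimg C k (preimg C h t) \<in> closed_subs C X \<mu>"
      using preimg_dimg_pullback[OF pb m tS] by simp
    then show ?thesis using closed_in_subspace_if[OF k] \<mu> preimg_in_Sub[OF D(4) tS] cod by simp
  qed
  then show "continuous_morphism C (Dom C k) (restricted C \<mu> k) (Dom C m) (restricted C \<phi> m) h"
    using D(4) by (simp add: continuous_morphism_def)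
qed

end

theorem mainTheorem11:
  fixes C :: "('o, 'a) fact_cat"
    and X Y Z :: 'o
    and \<mu> \<phi> \<psi> :: "'a set \<Rightarrow> 'a set set"
    and f g :: 'a
  assumes "fact_context C"
    and "preneighbourhood_space C X \<mu>"
    and "preneighbourhood_space C Y \<phi>"
    and "preneighbourhood_space C Z \<psi>"
    and "f \<in> Hom C X Y"
    and "g \<in> Hom C Y Z"
  shows
    "(closed_morphism C X \<mu> Y \<phi> f \<longleftrightarrow>
        (\<forall>p \<in> Sub C X. cl_hat C Y \<phi> (dimg C f p) \<sqsubseteq>\<^bsub>SubL C Y\<^esub> dimg C f (cl_hat C X \<mu> p)))
   \<and> (continuous_morphism C X \<mu> Y \<phi> f \<longrightarrow>
        (closed_morphism C X \<mu> Y \<phi> f \<longleftrightarrow>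
           (\<forall>p \<in> Sub C X. dimg C f (cl_hat C X \<mu> p) = cl_hat C Y \<phi> (dimg C f p))))
   \<and> (\<forall>m \<in> MM C. Cod C m = X \<longrightarrow>
        (closed_morphism C (Dom C m) (restricted C \<mu> m) X \<mu> m \<longleftrightarrow>
           sub_class C m \<in> closed_subs C X \<mu>))
   \<and> (\<forall>h. inverse_arrows C f h \<and> preneighbourhood_morphism C Y \<phi> X \<mu> h \<longrightarrow>
        closed_morphism C X \<mu> Y \<phi> f)
   \<and> (closed_morphism C X \<mu> Y \<phi> f \<and> closed_morphism C Y \<phi> Z \<psi> g \<longrightarrow>
        closed_morphism C X \<mu> Z \<psi> (g \<cdot>\<^bsub>C\<^esub> f))
   \<and> (closed_morphism C X \<mu> Z \<psi> (g \<cdot>\<^bsub>C\<^esub> f) \<and> formally_surjective C f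
        \<and> continuous_morphism C X \<mu> Y \<phi> f \<longrightarrow>
        closed_morphism C Y \<phi> Z \<psi> g)
   \<and> (closed_morphism C X \<mu> Y \<phi> f \<and> continuous_morphism C X \<mu> Y \<phi> f \<longrightarrow>
        (\<forall>m \<in> MM C. Cod C m = Y \<and> sub_class C m \<in> closed_subs C Y \<phi> \<longrightarrow>
           (\<forall>k f\<^sub>m. is_pullback C f m k f\<^sub>m \<longrightarrow>
              closed_morphism C (Dom C k) (restricted C \<mu> k) (Dom C m) (restricted C \<phi> m) f\<^sub>m
            \<and> continuous_morphism C (Dom C k) (restricted C \<mu> k) (Dom C m) (restricted C \<phi> m) f\<^sub>m)))"
proof -
  interpret fact_context C by (rule assms(1))
  have O: "X \<in> Obj C" "Y \<in> Obj C" using assms(2,3) by (auto simp: preneighbourhood_space_def)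
  note \<mu> = neighbourhood_assignmentI[OF assms(2)] and \<phi> = neighbourhood_assignmentI[OF assms(3)]
  show ?thesis
  proof (intro conjI impI ballI allI)
    show "closed_morphism C X \<mu> Y \<phi> f \<longleftrightarrow>
        (\<forall>p \<in> Sub C X. cl_hat C Y \<phi> (dimg C f p) \<sqsubseteq>\<^bsub>SubL C Y\<^esub> dimg C f (cl_hat C X \<mu> p))"
      by (rule closed_morphism_iff_cl_hat[OF O(1) \<mu> O(2) \<phi> assms(5)])
    show "closed_morphism C X \<mu> Y \<phi> f \<longleftrightarrow>
        (\<forall>p \<in> Sub C X. dimg C f (cl_hat C X \<mu> p) = cl_hat C Y \<phi> (dimg C f p))"
      if "continuous_morphism C X \<mu> Y \<phi> f"
      by (rule continuous_closed_iff_cl_hat[OF O(1) \<mu> O(2) \<phi> assms(5) that])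
    show "closed_morphism C (Dom C m) (restricted C \<mu> m) X \<mu> m \<longleftrightarrow> sub_class C m \<in> closed_subs C X \<mu>"
      if "m \<in> MM C" "Cod C m = X" for m
      using closed_embedding_iff[OF that(1)] \<mu> that(2) by simp
    show "closed_morphism C X \<mu> Y \<phi> f"
      if "inverse_arrows C f h \<and> preneighbourhood_morphism C Y \<phi> X \<mu> h" for h
      using closed_morphism_iso[OF O(1) \<mu> O(2) \<phi> assms(5)] that by blast
    show "closed_morphism C X \<mu> Z \<psi> (g \<cdot>\<^bsub>C\<^esub> f)"
      if "closed_morphism C X \<mu> Y \<phi> f \<and> closed_morphism C Y \<phi> Z \<psi> g"
      using closed_morphism_cmp that by blast
    show "closed_morphism C Y \<phi> Z \<psi> g"
      if "closed_morphism C X \<mu> Z \<psi> (g \<cdot>\<^bsub>C\<^esub> f) \<and> formally_surjective C f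
        \<and> continuous_morphism C X \<mu> Y \<phi> f"
      using closed_morphism_cancel_right[OF _ _ _ assms(6)] that by blast
    fix m k f\<^sub>m
    assume "closed_morphism C X \<mu> Y \<phi> f \<and> continuous_morphism C X \<mu> Y \<phi> f" and m: "m \<in> MM C"
      and "Cod C m = Y \<and> sub_class C m \<in> closed_subs C Y \<phi>" and pb: "is_pullback C f m k f\<^sub>m"
    then have h: "closed_morphism C X \<mu> Y \<phi> f" "continuous_morphism C X \<mu> Y \<phi> f"
      "sub_class C m \<in> closed_subs C Y \<phi>" by auto
    show "closed_morphism C (Dom C k) (restricted C \<mu> k) (Dom C m) (restricted C \<phi> m) f\<^sub>m"
      "continuous_morphism C (Dom C k) (restricted C \<mu> k) (Dom C m) (restricted C \<phi> m) f\<^sub>m"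
      using corestriction_closed_continuous[OF \<mu> \<phi> h(1,2) m h(3) pb] by auto
  qed
qed

end
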